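(* The following types of meromorphic ends of order $2$ can occur (after an affine change of coordinates putting the end in reduced form), these are all the possible types of order $2$, and they have the indicated properties: (1) $(1,2,2)$ (catenoidal): every end of this type is properly embedded; (2) $(0,2,2)$ (planar): every end of this type is properly embedded; (3) $(0,1,2)$: ends of this type can be properly embedded (i.e. there exist properly embedded ends of this type); (4) $(0,0,2)$: no end of this type is proper.
   Context: Let $\mathbb{D}^*=\{z\in\mathbb{C}: 0<|z|<1\}$. A meromorphic end is a harmonic map $f:\mathbb{D}^*\to\mathbb{R}^3$ of the form $f(z)=\operatorname{Re}\int^z(\omega_1,\omega_2,\omega_3)$, where $\omega_1,\omega_2,\omega_3$ are 1-forms holomorphic on $\mathbb{D}^*$ and meromorphic at $0$; since $f$ is single valued, the residues of the $\omega_k$ at $0$ are real. The pole order of a form holomorphic at $0$ is $0$. Two ends $f,\tilde f$ are affinely equivalent if $\tilde f=A\circ f$ for an invertible real affine map $A:\mathbb{R}^3\to\mathbb{R}^3$. An end is in reduced form if the pole orders $n_k$ of $\omega_k$ at $0$ satisfy $n_1\le n_2\le n_3$ and $(n_1,n_2,n_3)$ is lexicographically minimal among all affinely equivalent ends. The type of an end is the tuple $(n_1,n_2,n_3)$ of an affinely equivalent end in reduced form, and $n_3$ is the order of the end. An end is proper if $|f(z)|\to\infty$ as $z\to 0$; it is properly embedded if it is proper and its restriction to a sufficiently small punctured disk around $0$ is an injective immersion. *)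

theory Defs
  imports "HOL-Complex_Analysis.Complex_Analysis"
begin

unbundle no Formal_Power_Series.fps_syntax

definition punctured_disk :: "complex set" where
  "punctured_disk = {z. 0 < norm z \<and> norm z < 1}"

text \<open>
  The one-form with index \<open>k\<close> is written in the coordinate \<open>z\<close> as \<open>\<omega> z $ k dz\<close>.
\<close>

definition meromorphic_forms :: "(complex \<Rightarrow> complex ^ 3) \<Rightarrow> bool" where
  "meromorphic_forms \<omega> \<longleftrightarrow>
     (\<forall>k. (\<lambda>z. \<omega> z $ k) holomorphic_on punctured_disk \<and> (\<lambda>z. \<omega> z $ k) meromorphic_on {0})"

text \<open>
  \<open>f z = Re \<integral>\<^sup>z \<omega>\<close> on the punctured disk, up to the choice of base point and of the
  additive constant. Quantifying over all paths expresses that the integral is single valued;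
  this forces the residues at \<open>0\<close> to be real, and such an \<open>f\<close> is automatically harmonic.
  Values of \<open>f\<close> outside the punctured disk are irrelevant throughout.
\<close>

definition Re_integral_of :: "(complex \<Rightarrow> complex ^ 3) \<Rightarrow> (complex \<Rightarrow> real ^ 3) \<Rightarrow> bool" where
  "Re_integral_of \<omega> f \<longleftrightarrow>
     (\<forall>\<gamma>. valid_path \<gamma> \<and> path_image \<gamma> \<subseteq> punctured_disk \<longrightarrow>
        f (pathfinish \<gamma>) - f (pathstart \<gamma>) = (\<chi> k. Re (contour_integral \<gamma> (\<lambda>z. \<omega> z $ k))))"

definition meromorphic_end :: "(complex \<Rightarrow> real ^ 3) \<Rightarrow> bool" where
  "meromorphic_end f \<longleftrightarrow> (\<exists>\<omega>. meromorphic_forms \<omega> \<and> Re_integral_of \<omega> f)"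

definition pole_order :: "(complex \<Rightarrow> complex) \<Rightarrow> nat" where
  "pole_order g = (if is_pole g 0 then nat (- zorder g 0) else 0)"

text \<open>
  On the punctured disk the forms are determined by \<open>f\<close>, so an end has exactly one triple of
  pole orders.
\<close>

definition has_pole_orders :: "(complex \<Rightarrow> real ^ 3) \<Rightarrow> nat \<times> nat \<times> nat \<Rightarrow> bool" where
  "has_pole_orders f n \<longleftrightarrow>
     (\<exists>\<omega>. meromorphic_forms \<omega> \<and> Re_integral_of \<omega> f \<and>
        n = (pole_order (\<lambda>z. \<omega> z $ 1), pole_order (\<lambda>z. \<omega> z $ 2), pole_order (\<lambda>z. \<omega> z $ 3)))"

definition affinely_equivalent ::
    "(complex \<Rightarrow> real ^ 3) \<Rightarrow> (complex \<Rightarrow> real ^ 3) \<Rightarrow> bool" where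
  "affinely_equivalent f g \<longleftrightarrow>
     (\<exists>(M :: real ^ 3 ^ 3) v. invertible M \<and> (\<forall>z\<in>punctured_disk. g z = M *v f z + v))"

text \<open>
  The lexicographic order on triples is spelled out by \<open><*lex*>\<close>, since \<open>\<le>\<close> on products
  is the componentwise order here.
\<close>

definition reduced_form_with :: "(complex \<Rightarrow> real ^ 3) \<Rightarrow> nat \<times> nat \<times> nat \<Rightarrow> bool" where
  "reduced_form_with f n \<longleftrightarrow>
     has_pole_orders f n \<and> fst n \<le> fst (snd n) \<and> fst (snd n) \<le> snd (snd n) \<and>
     (\<forall>g m. affinely_equivalent f g \<and> has_pole_orders g m \<longrightarrow>
        (m, n) \<notin> less_than <*lex*> less_than <*lex*> less_than)"

definition end_type :: "(complex \<Rightarrow> real ^ 3) \<Rightarrow> nat \<times> nat \<times> nat" where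
  "end_type f = (THE n. \<exists>g. affinely_equivalent f g \<and> reduced_form_with g n)"

definition end_order :: "(complex \<Rightarrow> real ^ 3) \<Rightarrow> nat" where
  "end_order f = snd (snd (end_type f))"

definition proper_end :: "(complex \<Rightarrow> real ^ 3) \<Rightarrow> bool" where
  "proper_end f \<longleftrightarrow> filterlim (\<lambda>z. norm (f z)) at_top (at 0)"

definition immersion_on :: "(complex \<Rightarrow> real ^ 3) \<Rightarrow> complex set \<Rightarrow> bool" where
  "immersion_on f S \<longleftrightarrow> (\<forall>z\<in>S. \<exists>D. (f has_derivative D) (at z) \<and> inj D)"

definition properly_embedded_end :: "(complex \<Rightarrow> real ^ 3) \<Rightarrow> bool" where
  "properly_embedded_end f \<longleftrightarrow> proper_end f \<and>
     (\<exists>r. 0 < r \<and> r \<le> 1 \<and> inj_on f (ball 0 r - {0}) \<and> immersion_on f (ball 0 r - {0}))"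


text \<open>The type of an end is well defined, so the definite description above is harmless.\<close>

lemma affinely_equivalent_refl: "affinely_equivalent f f"
  unfolding affinely_equivalent_def
  by (rule exI[of _ "mat 1"], rule exI[of _ 0]) (auto simp: invertible_def)

lemma affinely_equivalent_trans:
  assumes "affinely_equivalent f g" "affinely_equivalent g h"
  shows "affinely_equivalent f h"
proof -
  obtain M v where M: "invertible M" "\<And>z. z \<in> punctured_disk \<Longrightarrow> g z = M *v f z + v"
    using assms(1) unfolding affinely_equivalent_def by blast
  obtain N w where N: "invertible N" "\<And>z. z \<in> punctured_disk \<Longrightarrow> h z = N *v g z + w"
    using assms(2) unfolding affinely_equivalent_def by blast
  have "\<forall>z\<in>punctured_disk. h z = (N ** M) *v f z + (N *v v + w)"
    by (simp add: M N matrix_vector_right_distrib matrix_vector_mul_assoc add.assoc)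
  then show ?thesis
    using invertible_mult[OF N(1) M(1)] unfolding affinely_equivalent_def by blast
qed

lemma affinely_equivalent_sym:
  assumes "affinely_equivalent f g"
  shows "affinely_equivalent g f"
proof -
  obtain M v where M: "invertible M" "\<And>z. z \<in> punctured_disk \<Longrightarrow> g z = M *v f z + v"
    using assms unfolding affinely_equivalent_def by blast
  obtain N where N: "M ** N = mat 1" "N ** M = mat 1"
    using M(1) unfolding invertible_def by blast
  have "\<forall>z\<in>punctured_disk. f z = N *v g z + - (N *v v)"
    by (simp add: M matrix_vector_right_distrib matrix_vector_mul_assoc N)
  moreover have "invertible N"
    using N unfolding invertible_def by blast
  ultimately show ?thesis
    unfolding affinely_equivalent_def by blast
qed

lemma swap_coordinates:
  fixes \<omega> :: "complex \<Rightarrow> complex ^ 3" and f :: "complex \<Rightarrow> real ^ 3" and i j :: 3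
  assumes "meromorphic_forms \<omega>" "Re_integral_of \<omega> f"
  defines "t \<equiv> Transposition.transpose i j"
  shows "meromorphic_forms (\<lambda>z. \<chi> k. \<omega> z $ t k)"
    and "Re_integral_of (\<lambda>z. \<chi> k. \<omega> z $ t k) (\<lambda>z. \<chi> k. f z $ t k)"
    and "affinely_equivalent f (\<lambda>z. \<chi> k. f z $ t k)"
proof -
  show "meromorphic_forms (\<lambda>z. \<chi> k. \<omega> z $ t k)"
    using assms(1) by (simp add: meromorphic_forms_def)
  show "Re_integral_of (\<lambda>z. \<chi> k. \<omega> z $ t k) (\<lambda>z. \<chi> k. f z $ t k)"
    using assms(2) by (simp add: Re_integral_of_def vec_eq_iff)
  define M :: "real ^ 3 ^ 3" where "M = (\<chi> a b. if b = t a then 1 else 0)"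
  have M: "M *v x = (\<chi> k. x $ t k)" for x
    by (simp add: M_def matrix_vector_mult_def vec_eq_iff if_distrib[of "\<lambda>c. c * _"] cong: if_cong)
  have "(M ** M) *v x = mat 1 *v x" for x
    by (simp add: matrix_vector_mul_assoc[symmetric] M t_def vec_eq_iff)
  then have "M ** M = mat 1"
    using matrix_eq by blast
  then have "invertible M"
    unfolding invertible_def by blast
  then show "affinely_equivalent f (\<lambda>z. \<chi> k. f z $ t k)"
    unfolding affinely_equivalent_def by (intro exI[of _ M] exI[of _ 0]) (simp add: M)
qed

lemma ex1_end_type:
  assumes "meromorphic_end f"
  shows "\<exists>!n. \<exists>g. affinely_equivalent f g \<and> reduced_form_with g n"
proof (rule ex_ex1I)
  let ?lex = "less_than <*lex*> less_than <*lex*> less_than"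
  define Q where "Q = {n. \<exists>g. affinely_equivalent f g \<and> has_pole_orders g n}"
  have "Q \<noteq> {}"
    using assms affinely_equivalent_refl[of f]
    unfolding Q_def meromorphic_end_def has_pole_orders_def by blast
  moreover have "wf ?lex"
    by (intro wf_lex_prod wf_less_than)
  ultimately obtain n where n: "n \<in> Q" "\<And>m. (m, n) \<in> ?lex \<Longrightarrow> m \<notin> Q"
    by (metis wf_eq_minimal ex_in_conv)
  obtain g where g: "affinely_equivalent f g" "has_pole_orders g n"
    using n(1) unfolding Q_def by blast
  obtain \<omega> where \<omega>: "meromorphic_forms \<omega>" "Re_integral_of \<omega> g"
      "n = (pole_order (\<lambda>z. \<omega> z $ 1), pole_order (\<lambda>z. \<omega> z $ 2), pole_order (\<lambda>z. \<omega> z $ 3))"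
    using g(2) unfolding has_pole_orders_def by blast
  have swap: "(pole_order (\<lambda>z. \<omega> z $ Transposition.transpose i j 1),
      pole_order (\<lambda>z. \<omega> z $ Transposition.transpose i j 2),
      pole_order (\<lambda>z. \<omega> z $ Transposition.transpose i j 3)) \<in> Q" for i j :: 3
    unfolding Q_def has_pole_orders_def mem_Collect_eq
    using swap_coordinates[OF \<omega>(1,2), of i j] affinely_equivalent_trans[OF g(1)]
    by (intro exI[of _ "\<lambda>z. \<chi> k. g z $ Transposition.transpose i j k"] conjI
        exI[of _ "\<lambda>z. \<chi> k. \<omega> z $ Transposition.transpose i j k"]) auto
  have not_less: "(m, n) \<notin> ?lex" if "m \<in> Q" for m
    using n(2) that by blast
  have "fst n \<le> fst (snd n)"
    using not_less[OF swap[of 1 2]] by (simp add: Transposition.transpose_def \<omega>(3))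
  moreover have "fst (snd n) \<le> snd (snd n)"
    using not_less[OF swap[of 2 3]] by (simp add: Transposition.transpose_def \<omega>(3))
  moreover have "(m, n) \<notin> ?lex" if "affinely_equivalent g h" "has_pole_orders h m" for h m
    using n(2) affinely_equivalent_trans[OF g(1) that(1)] that(2) unfolding Q_def by blast
  ultimately show "\<exists>n g. affinely_equivalent f g \<and> reduced_form_with g n"
    using g unfolding reduced_form_with_def by blast
next
  fix m n
  assume "\<exists>g. affinely_equivalent f g \<and> reduced_form_with g m"
    and "\<exists>g. affinely_equivalent f g \<and> reduced_form_with g n"
  then obtain g h where *: "affinely_equivalent f g" "reduced_form_with g m"
      "affinely_equivalent f h" "reduced_form_with h n"
    by blast
  have "affinely_equivalent g h" "affinely_equivalent h g"
    using * affinely_equivalent_sym affinely_equivalent_trans by blast+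
  then have "(n, m) \<notin> less_than <*lex*> less_than <*lex*> less_than"
      "(m, n) \<notin> less_than <*lex*> less_than <*lex*> less_than"
    using *(2,4) unfolding reduced_form_with_def by blast+
  then show "m = n"
    by (cases m; cases n) auto
qed

end

theory Submission
  imports Defs
begin

text \<open>
  A form of pole order at most 2 is \<open>(a/z\<^sup>2 + r/z + h(z)) dz\<close> with \<open>h\<close> holomorphic, and \<open>r\<close> is
  real, so an end of order 2 has the coordinates \<open>f\<^sub>k = Re(-a\<^sub>k/z) + r\<^sub>k ln|z| + smooth\<close>. An affine
  change acts linearly on the vectors \<open>a \<in> \<complex>\<^sup>3\<close> and \<open>r \<in> \<real>\<^sup>3\<close>, and the type depends on them alone.
  In the types \<open>(1,2,2)\<close> and \<open>(0,2,2)\<close> the \<open>a\<^sub>k\<close> span \<open>\<complex>\<close> over \<open>\<real>\<close>; then the term \<open>1/z\<close>, which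
  separates \<open>z\<close> and \<open>w\<close> by \<open>|z-w| / |zw|\<close>, dominates the logarithm and the smooth part near \<open>0\<close>.
  In the type \<open>(0,0,2)\<close> only the third coordinate is unbounded, and it stays bounded along a
  suitable curve into \<open>0\<close>.
\<close>

section \<open>Ends as primitives of meromorphic forms\<close>

lemma open_punctured_disk: "open punctured_disk"
  unfolding punctured_disk_def by (intro open_Collect_conj open_Collect_less continuous_intros)

lemma punctured_disk_eq: "punctured_disk = ball 0 1 - {0}"
  by (auto simp: punctured_disk_def)

lemma connected_punctured_disk: "connected punctured_disk"
  unfolding punctured_disk_eq
  by (intro connected_open_delete) (auto simp: DIM_complex)

lemma eventually_punctured_disk: "eventually (\<lambda>z. z \<in> punctured_disk) (at 0)"
  unfolding punctured_disk_eq
  by (rule eventually_at_in_open) auto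

text \<open>On a small disc around \<open>z\<close> the form has a primitive \<open>G\<close>, and
  integrating along the segment from \<open>z\<close> to \<open>w\<close> identifies the coordinate
  with \<open>Re (G w)\<close> up to a constant.\<close>

lemma has_derivative_of_Re_integral:
  assumes "meromorphic_forms \<omega>" "Re_integral_of \<omega> f" "z \<in> punctured_disk"
  shows "((\<lambda>w. f w $ k) has_derivative (\<lambda>h. Re (\<omega> z $ k * h))) (at z)"
proof -
  obtain e where e: "e > 0" "ball z e \<subseteq> punctured_disk"
    using open_punctured_disk assms(3) by (meson open_contains_ball)
  have hol: "(\<lambda>w. \<omega> w $ k) holomorphic_on ball z e"
    using assms(1) e(2) holomorphic_on_subset unfolding meromorphic_forms_def by blast
  obtain G where G: "\<And>x. x \<in> ball z e \<Longrightarrow> (G has_field_derivative \<omega> x $ k) (at x within ball z e)"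
    using holomorphic_convex_primitive'[OF convex_ball open_ball hol] by blast
  have eq: "f w $ k = f z $ k + Re (G w - G z)" if w: "w \<in> ball z e" for w
  proof -
    have sub: "path_image (linepath z w) \<subseteq> ball z e"
      using w e(1) by (simp add: closed_segment_subset)
    have "((\<lambda>w. \<omega> w $ k) has_contour_integral (G w - G z)) (linepath z w)"
      using contour_integral_primitive[OF G valid_path_linepath sub] by simp
    then have "contour_integral (linepath z w) (\<lambda>w. \<omega> w $ k) = G w - G z"
      by (rule contour_integral_unique)
    moreover have "f w - f z = (\<chi> k. Re (contour_integral (linepath z w) (\<lambda>z. \<omega> z $ k)))"
      using assms(2) sub e(2) unfolding Re_integral_of_def
      by (metis order_trans pathfinish_linepath pathstart_linepath valid_path_linepath)
    ultimately have "(f w - f z) $ k = Re (G w - G z)"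
      by simp
    then show ?thesis
      by simp
  qed
  have "(G has_field_derivative \<omega> z $ k) (at z)"
    using G[of z] e(1) by (simp add: at_within_open[OF _ open_ball])
  then have "((\<lambda>w. f z $ k + Re (G w - G z)) has_derivative (\<lambda>h. Re (\<omega> z $ k * h))) (at z)"
    unfolding has_field_derivative_def by (auto intro!: derivative_eq_intros)
  then show ?thesis
  proof (rule has_derivative_transform_within_open[OF _ open_ball])
    show "z \<in> ball z e"
      using e(1) by simp
    show "f z $ k + Re (G w - G z) = f w $ k" if "w \<in> ball z e" for w
      using eq[OF that] by (rule sym)
  qed
qed

text \<open>Converse of the derivative formula, by the fundamental theorem of calculus along the
  path. It recognises explicit formulas and affine images as ends without evaluating contour
  integrals.\<close>

lemma Re_integral_ofI:
  assumes hol: "\<And>k. (\<lambda>z. \<omega> z $ k) holomorphic_on punctured_disk"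
    and der: "\<And>z k. z \<in> punctured_disk \<Longrightarrow>
      ((\<lambda>w. f w $ k) has_derivative (\<lambda>h. Re (\<omega> z $ k * h))) (at z)"
  shows "Re_integral_of \<omega> f"
  unfolding Re_integral_of_def
proof (intro allI impI, elim conjE)
  fix \<gamma> :: "real \<Rightarrow> complex"
  assume \<gamma>: "valid_path \<gamma>" "path_image \<gamma> \<subseteq> punctured_disk"
  obtain S where S: "finite S" "\<And>x. x \<in> {0..1} - S \<Longrightarrow> \<gamma> differentiable at x"
    and cont: "continuous_on {0..1} \<gamma>"
    using \<gamma>(1) unfolding valid_path_def piecewise_C1_differentiable_on_def
    by (metis C1_differentiable_on_eq)
  have in_disk: "\<gamma> x \<in> punctured_disk" if "x \<in> {0..1}" for x
    using that \<gamma>(2) unfolding path_image_def by blast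
  have "(f (\<gamma> 1) - f (\<gamma> 0)) $ k = Re (contour_integral \<gamma> (\<lambda>z. \<omega> z $ k))" for k
  proof -
    \<comment> \<open>A valid path is only piecewise C1; differentiability is asked for outside the
      finite set \<open>S\<close>, continuity everywhere.\<close>
    have "((\<lambda>x. Re (\<omega> (\<gamma> x) $ k * vector_derivative \<gamma> (at x)))
        has_integral (f (\<gamma> 1) $ k - f (\<gamma> 0) $ k)) {0..1}"
    proof (rule fundamental_theorem_of_calculus_interior_strong[OF S(1), where f = "\<lambda>x. f (\<gamma> x) $ k"])
      fix x :: real
      assume x: "x \<in> {0<..<1} - S"
      then have v: "(\<gamma> has_vector_derivative vector_derivative \<gamma> (at x)) (at x)"
        using S(2)[of x] by (simp add: vector_derivative_works)
      show "((\<lambda>x. f (\<gamma> x) $ k) has_vector_derivative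
          Re (\<omega> (\<gamma> x) $ k * vector_derivative \<gamma> (at x))) (at x)"
        using has_derivative_compose[OF v[unfolded has_vector_derivative_def] der[OF in_disk, of x k]] x
        by (simp add: has_vector_derivative_def mult.assoc mult.left_commute)
    next
      have "continuous_on punctured_disk (\<lambda>w. f w $ k)"
        using der by (meson continuous_at_imp_continuous_on has_derivative_continuous)
      then show "continuous_on {0..1} (\<lambda>x. f (\<gamma> x) $ k)"
        by (rule continuous_on_compose2[OF _ cont]) (use in_disk in blast)
    qed simp
    moreover have "(\<lambda>z. \<omega> z $ k) contour_integrable_on \<gamma>"
      using contour_integrable_holomorphic_simple[OF hol open_punctured_disk \<gamma>] .
    then have int: "((\<lambda>x. \<omega> (\<gamma> x) $ k * vector_derivative \<gamma> (at x))
        has_integral contour_integral \<gamma> (\<lambda>z. \<omega> z $ k)) {0..1}"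
      using has_contour_integral_integral has_contour_integral[of "\<lambda>z. \<omega> z $ k" _ \<gamma>] by blast
    have "((\<lambda>x. Re (\<omega> (\<gamma> x) $ k * vector_derivative \<gamma> (at x)))
        has_integral Re (contour_integral \<gamma> (\<lambda>z. \<omega> z $ k))) {0..1}"
      using has_integral_linear[OF int bounded_linear_Re] unfolding o_def .
    ultimately show ?thesis
      unfolding vector_minus_component by (rule has_integral_unique)
  qed
  then show "f (pathfinish \<gamma>) - f (pathstart \<gamma>) = (\<chi> k. Re (contour_integral \<gamma> (\<lambda>z. \<omega> z $ k)))"
    by (simp add: vec_eq_iff pathfinish_def pathstart_def)
qed

lemma Re_integral_of_unique:
  assumes "meromorphic_forms \<omega>" "Re_integral_of \<omega> f" "meromorphic_forms \<eta>" "Re_integral_of \<eta> f"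
    and "z \<in> punctured_disk"
  shows "\<omega> z = \<eta> z"
proof -
  have "Re (\<omega> z $ k * h) = Re (\<eta> z $ k * h)" for k h
    using has_derivative_unique[OF has_derivative_of_Re_integral[OF assms(1,2,5)]
        has_derivative_of_Re_integral[OF assms(3,4,5)]] by metis
  \<comment> \<open>Testing with \<open>h = 1\<close> compares the real parts, with
    \<open>h = - \<i>\<close> the imaginary parts.\<close>
  from this[of _ 1] this[of _ "- \<i>"] show ?thesis
    by (simp add: vec_eq_iff complex_eq_iff)
qed

text \<open>The operator \<open>*v\<close> does not mix a real matrix with a complex vector, so the
  entries are embedded by \<open>of_real\<close>. The same map acts on the forms, on the double-pole
  coefficients and on the residues.\<close>

definition transform :: "real ^ 3 ^ 3 \<Rightarrow> complex ^ 3 \<Rightarrow> complex ^ 3" where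
  "transform M c = (\<chi> k. \<Sum>j\<in>UNIV. of_real (M $ k $ j) * c $ j)"

text \<open>Real entries commute with \<open>Re\<close>, and the translation disappears on
  differentiating, so an affine change of the end is a linear change of its forms.\<close>

lemma Re_integral_of_affine:
  assumes \<omega>: "meromorphic_forms \<omega>" "Re_integral_of \<omega> f"
    and g: "\<And>z. z \<in> punctured_disk \<Longrightarrow> g z = M *v f z + v"
  shows "meromorphic_forms (\<lambda>z. transform M (\<omega> z))"
    and "Re_integral_of (\<lambda>z. transform M (\<omega> z)) g"
proof -
  show mf: "meromorphic_forms (\<lambda>z. transform M (\<omega> z))"
    using \<omega>(1) unfolding meromorphic_forms_def transform_def
    by (auto intro!: holomorphic_intros meromorphic_intros)
  show "Re_integral_of (\<lambda>z. transform M (\<omega> z)) g"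
  proof (rule Re_integral_ofI)
    show "(\<lambda>z. transform M (\<omega> z) $ k) holomorphic_on punctured_disk" for k
      using mf unfolding meromorphic_forms_def by blast
  next
    fix z k assume z: "z \<in> punctured_disk"
    have "((\<lambda>w. (\<Sum>j\<in>UNIV. M $ k $ j * f w $ j) + v $ k) has_derivative
        (\<lambda>h. (\<Sum>j\<in>UNIV. M $ k $ j * Re (\<omega> z $ j * h)) + 0)) (at z)"
      by (intro has_derivative_add has_derivative_sum has_derivative_mult_right has_derivative_const
          has_derivative_of_Re_integral[OF \<omega> z])
    moreover have "(\<lambda>h. (\<Sum>j\<in>UNIV. M $ k $ j * Re (\<omega> z $ j * h)) + 0) = (\<lambda>h. Re (transform M (\<omega> z) $ k * h))"
      by (simp add: transform_def sum_distrib_right Re_sum mult.assoc)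
    ultimately have "((\<lambda>w. (\<Sum>j\<in>UNIV. M $ k $ j * f w $ j) + v $ k) has_derivative
        (\<lambda>h. Re (transform M (\<omega> z) $ k * h))) (at z)"
      by simp
    then show "((\<lambda>w. g w $ k) has_derivative (\<lambda>h. Re (transform M (\<omega> z) $ k * h))) (at z)"
      by (rule has_derivative_transform_within_open[OF _ open_punctured_disk z])
        (simp add: g matrix_vector_mult_def)
  qed
qed

section \<open>Principal parts\<close>

text \<open>The coefficient \<open>a\<close> may vanish, so every pole order up to 2 is covered;
  \<open>r\<close> is the residue. The remainder \<open>h\<close> is holomorphic across 0.\<close>

definition principal_part :: "(complex \<Rightarrow> complex) \<Rightarrow> complex \<Rightarrow> complex \<Rightarrow> bool" where
  "principal_part g a r \<longleftrightarrow>
     (\<exists>h. h holomorphic_on ball 0 1 \<and> (\<forall>z\<in>punctured_disk. g z = a / z\<^sup>2 + r / z + h z))"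

text \<open>The product of \<open>g\<close> with the square of \<open>z\<close> has a limit at 0, so
  its singularity is removable; splitting off the first two Taylor coefficients of the extension
  leaves \<open>h\<close>.\<close>

lemma principal_part_exists:
  assumes hol: "g holomorphic_on punctured_disk" and mero: "g meromorphic_on {0}"
    and order: "pole_order g \<le> 2"
  shows "\<exists>a r. principal_part g a r"
proof -
  define p where "p = (\<lambda>z. z\<^sup>2 * g z)"
  have "\<exists>L. (p \<longlongrightarrow> L) (at 0)"
  proof (cases "is_pole g 0")
    case True
    define n where "n = nat (- zorder g 0)"
    have n: "n \<le> 2"
      using order True by (simp add: pole_order_def n_def)
    obtain r where r: "r > 0" "zor_poly g 0 holomorphic_on cball 0 r"
        "\<forall>w\<in>cball 0 r - {0}. g w = zor_poly g 0 w / (w - 0) ^ n"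
      using zorder_exist_pole[of g "ball 0 1" 0] hol True unfolding punctured_disk_eq n_def by auto
    \<comment> \<open>The exponent \<open>2 - n\<close> is a true difference because
      \<open>n \<le> 2\<close>; hence \<open>?q\<close> is a continuous extension of
      \<open>p\<close>.\<close>
    let ?q = "\<lambda>w. zor_poly g 0 w * w ^ (2 - n)"
    have "continuous_on (cball 0 r) ?q"
      using r(2) by (intro continuous_intros holomorphic_on_imp_continuous_on)
    then have "isCont ?q 0"
      by (rule continuous_on_interior) (use r(1) in \<open>simp add: interior_cball\<close>)
    then have "?q \<midarrow>0\<rightarrow> ?q 0"
      by (simp add: isCont_def)
    moreover have "eventually (\<lambda>w. ?q w = p w) (at 0)"
    proof -
      have "?q w = p w" if "w \<in> ball 0 r - {0}" for w
      proof -
        have "w ^ (2 - n) * w ^ n = w\<^sup>2"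
          using n by (simp flip: power_add)
        then have "w\<^sup>2 / w ^ n = w ^ (2 - n)"
          using that by (simp add: field_simps)
        then show ?thesis
          using r(3) that by (auto simp: p_def field_simps)
      qed
      then show ?thesis
        using r(1) eventually_at_in_open[of "ball 0 r" 0] by (auto elim!: eventually_mono)
    qed
    ultimately show ?thesis
      using Lim_transform_eventually by blast
  next
    case False
    then obtain x where "(g \<longlongrightarrow> x) (at 0)"
      using mero unfolding meromorphic_at_iff not_essential_def by blast
    then have "(p \<longlongrightarrow> 0\<^sup>2 * x) (at 0)"
      unfolding p_def by (intro tendsto_intros)
    then show ?thesis by blast
  qed
  then obtain L where "(p \<longlongrightarrow> L) (at 0)" by blast
  then have "((\<lambda>z. (z - 0) * p z) \<longlongrightarrow> (0 - 0) * L) (at 0)"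
    by (intro tendsto_intros)
  moreover have "p holomorphic_on ball 0 1 - {0}"
    unfolding p_def using hol unfolding punctured_disk_eq by (intro holomorphic_intros)
  ultimately obtain P where P: "P holomorphic_on ball 0 1" "\<And>z. z \<in> ball 0 1 - {0} \<Longrightarrow> P z = p z"
    using holomorphic_on_extend_lim[where f = p and \<xi> = 0 and S = "ball 0 1"] by auto
  \<comment> \<open>Two successive difference quotients at 0, with the derivative as value there so
    that each is holomorphic across 0. Then \<open>P 0\<close> and \<open>Q 0\<close> are the wanted
    coefficients.\<close>
  define Q where "Q = (\<lambda>z. if z = 0 then deriv P 0 else (P z - P 0) / (z - 0))"
  define h where "h = (\<lambda>z. if z = 0 then deriv Q 0 else (Q z - Q 0) / (z - 0))"
  have "Q holomorphic_on ball 0 1"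
    unfolding Q_def using P(1) by (rule pole_lemma_open) simp
  then have "h holomorphic_on ball 0 1"
    unfolding h_def by (rule pole_lemma_open) simp
  moreover have "g z = P 0 / z\<^sup>2 + Q 0 / z + h z" if "z \<in> punctured_disk" for z
  proof -
    have z: "z \<noteq> 0" using that by (auto simp: punctured_disk_def)
    have "P z = P 0 + z * Q 0 + z\<^sup>2 * h z"
      using z by (simp add: h_def Q_def field_simps power2_eq_square)
    then show ?thesis
      using P(2)[of z] that z unfolding punctured_disk_eq p_def
      by (auto simp: field_simps power2_eq_square)
  qed
  ultimately show ?thesis
    unfolding principal_part_def by blast
qed

definition principal_order :: "complex \<Rightarrow> complex \<Rightarrow> nat" where
  "principal_order a r = (if a \<noteq> 0 then 2 else if r \<noteq> 0 then 1 else 0)"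

lemma pole_order_eqI:
  assumes q: "q holomorphic_on ball 0 1" "q 0 \<noteq> 0" and n: "n > 0"
    and g: "\<And>z. z \<in> punctured_disk \<Longrightarrow> g z = q z / z ^ n"
  shows "pole_order g = n"
proof -
  have "zorder g 0 = - int n"
  proof (rule zorder_eqI[OF open_ball _ q(1)])
    show "g w = q w * (w - 0) powi - int n" if "w \<in> ball 0 1" "w \<noteq> 0" for w
      using that g[of w] by (auto simp: punctured_disk_def power_int_minus field_simps)
  qed (use q(2) in auto)
  moreover have "is_pole g 0"
  proof -
    have "(q \<longlongrightarrow> q 0) (at 0)"
      using q(1) by (metis centre_in_ball continuous_on_interior holomorphic_on_imp_continuous_on
          interior_open isCont_def open_ball zero_less_one)
    moreover have "filterlim (\<lambda>z::complex. z ^ n) (at 0) (at 0)"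
      using n by (auto simp: filterlim_at eventually_at_filter intro!: tendsto_eq_intros)
    ultimately have "is_pole (\<lambda>z. q z / z ^ n) 0"
      unfolding is_pole_def using q(2) by (intro filterlim_divide_at_infinity)
    moreover have "eventually (\<lambda>z. q z / z ^ n = g z) (at 0)"
      using eventually_punctured_disk by eventually_elim (simp add: g)
    ultimately show ?thesis
      unfolding is_pole_def using filterlim_cong by fast
  qed
  ultimately show ?thesis
    by (simp add: pole_order_def)
qed

lemma pole_order_principal_part:
  assumes "principal_part g a r"
  shows "pole_order g = principal_order a r"
proof -
  obtain h where h: "h holomorphic_on ball 0 1"
      and g: "\<And>z. z \<in> punctured_disk \<Longrightarrow> g z = a / z\<^sup>2 + r / z + h z"
    using assms unfolding principal_part_def by blast
  have nz: "z \<noteq> 0" if "z \<in> punctured_disk" for z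
    using that by (auto simp: punctured_disk_def)
  consider "a \<noteq> 0" | "a = 0" "r \<noteq> 0" | "a = 0" "r = 0" by blast
  then show ?thesis
  proof cases
    case 1
    have "pole_order g = 2"
      by (rule pole_order_eqI[where q = "\<lambda>z. a + r * z + z\<^sup>2 * h z"])
        (use 1 h nz in \<open>auto intro!: holomorphic_intros simp: g field_simps power2_eq_square\<close>)
    then show ?thesis using 1 by (simp add: principal_order_def)
  next
    case 2
    have "pole_order g = 1"
      by (rule pole_order_eqI[where q = "\<lambda>z. r + z * h z"])
        (use 2 h nz in \<open>auto intro!: holomorphic_intros simp: g field_simps\<close>)
    then show ?thesis using 2 by (simp add: principal_order_def)
  next
    case 3
    have "(h \<longlongrightarrow> h 0) (at 0)"
      using h by (metis centre_in_ball continuous_on_interior holomorphic_on_imp_continuous_on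
          interior_open isCont_def open_ball zero_less_one)
    moreover have "eventually (\<lambda>z. h z = g z) (at 0)"
      using eventually_punctured_disk by eventually_elim (simp add: g 3)
    ultimately have "(g \<longlongrightarrow> h 0) (at 0)"
      using Lim_transform_eventually by blast
    then have "\<not> is_pole g 0"
      using not_tendsto_and_filterlim_at_infinity[of "at 0" g "h 0"] by (auto simp: is_pole_def)
    then show ?thesis using 3 by (simp add: principal_order_def pole_order_def)
  qed
qed

lemma principal_part_transform:
  assumes "\<And>k. principal_part (\<lambda>z. \<omega> z $ k) (A $ k) (R $ k)"
  shows "principal_part (\<lambda>z. transform M (\<omega> z) $ k) (transform M A $ k) (transform M R $ k)"
proof -
  obtain h where h: "\<And>k. h k holomorphic_on ball 0 1"
      "\<And>k z. z \<in> punctured_disk \<Longrightarrow> \<omega> z $ k = A $ k / z\<^sup>2 + R $ k / z + h k z"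
    using assms unfolding principal_part_def by metis
  have "(\<lambda>z. \<Sum>j\<in>UNIV. of_real (M $ k $ j) * h j z) holomorphic_on ball 0 1"
    by (intro holomorphic_intros h)
  then show ?thesis
    unfolding principal_part_def
    by (intro exI[of _ "\<lambda>z. \<Sum>j\<in>UNIV. of_real (M $ k $ j) * h j z"])
      (auto simp: h(2) transform_def ring_distribs sum.distrib sum_divide_distrib)
qed

section \<open>Real residues and the normal form of a coordinate\<close>

text \<open>Around a circle a single-valued \<open>f\<close> returns to its value, so the integral
  of the form has real part 0. The double pole has the primitive \<open>- a / z\<close> and
  \<open>h\<close> integrates to 0, so that integral is \<open>2 * pi * \<i> * r\<close>.\<close>

lemma residue_real:
  assumes "meromorphic_forms \<omega>" "Re_integral_of \<omega> f" "principal_part (\<lambda>z. \<omega> z $ k) a r"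
  shows "Im r = 0"
proof -
  obtain h where h: "h holomorphic_on ball 0 1"
      and g: "\<And>z. z \<in> punctured_disk \<Longrightarrow> \<omega> z $ k = a / z\<^sup>2 + r / z + h z"
    using assms(3) unfolding principal_part_def by blast
  let ?c = "circlepath 0 (1/2)"
  have img: "path_image ?c \<subseteq> punctured_disk"
    by (auto simp: punctured_disk_def)
  have "(\<chi> k. Re (contour_integral ?c (\<lambda>z. \<omega> z $ k))) = 0"
    using assms(2) img unfolding Re_integral_of_def
    by (metis cancel_comm_monoid_add_class.diff_cancel circlepath_def pathfinish_circlepath pathstart_circlepath valid_path_circlepath)
  then have "Re (contour_integral ?c (\<lambda>z. \<omega> z $ k)) = 0"
    by (metis vec_lambda_beta zero_index)
  moreover have "((\<lambda>z. a / z\<^sup>2 + r * (1 / (z - 0)) + h z) has_contour_integral (0 + r * (2 * of_real pi * \<i>) + 0)) ?c"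
  proof (intro has_contour_integral_add has_contour_integral_lmul)
    have "((\<lambda>z. - a / z) has_field_derivative a / z\<^sup>2) (at z within punctured_disk)"
      if "z \<in> punctured_disk" for z
      using that by (auto intro!: derivative_eq_intros simp: punctured_disk_def power2_eq_square)
    from contour_integral_primitive[OF this _ img]
    show "((\<lambda>z. a / z\<^sup>2) has_contour_integral 0) ?c"
      by simp
    show "((\<lambda>z. 1 / (z - 0)) has_contour_integral 2 * of_real pi * \<i>) ?c"
      using Cauchy_integral_circlepath_simple[of "\<lambda>_. 1" 0 "1/2" 0] by simp
    show "(h has_contour_integral 0) ?c"
      by (rule Cauchy_theorem_disc_simple[OF h]) (auto simp: dist_norm)
  qed
  then have "((\<lambda>z. \<omega> z $ k) has_contour_integral (0 + r * (2 * of_real pi * \<i>) + 0)) ?c"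
    by (rule has_contour_integral_eq) (use img g in \<open>simp add: subset_iff\<close>)
  then have "contour_integral ?c (\<lambda>z. \<omega> z $ k) = 0 + r * (2 * of_real pi * \<i>) + 0"
    by (rule contour_integral_unique)
  ultimately show ?thesis
    by simp
qed

text \<open>The logarithm has no branch on the punctured disk, but its real part is globally
  defined; its derivative is computed from that of the norm, \<open>sgn z\<close>.\<close>

lemma has_derivative_ln_norm:
  assumes "z \<noteq> (0::complex)"
  shows "((\<lambda>w. ln (norm w)) has_derivative (\<lambda>h. Re (h / z))) (at z)"
proof -
  have "((\<lambda>w. ln (norm w)) has_derivative (\<lambda>h. (h \<bullet> sgn z) * inverse (norm z))) (at z)"
    using assms by (auto intro!: derivative_eq_intros has_derivative_norm simp: field_simps)
  moreover have "(h \<bullet> sgn z) * inverse (norm z) = Re (h / z)" for h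
  proof -
    have "Re (h / z) = (h \<bullet> z) / (norm z)\<^sup>2"
      by (simp add: Re_divide inner_complex_def cmod_power2)
    then show ?thesis
      by (simp add: sgn_div_norm field_simps power2_eq_square)
  qed
  ultimately show ?thesis by simp
qed

text \<open>The explicit expression and the coordinate of \<open>f\<close> have the same derivative,
  so their difference is constant on the connected punctured disk.\<close>

lemma end_normal_form:
  assumes \<omega>: "meromorphic_forms \<omega>" "Re_integral_of \<omega> f"
    and pp: "principal_part (\<lambda>z. \<omega> z $ k) a r"
  obtains H where "H holomorphic_on ball 0 1"
    and "\<And>z. z \<in> punctured_disk \<Longrightarrow> f z $ k = Re (- a / z) + Re r * ln (norm z) + Re (H z)"
proof -
  obtain h where h: "h holomorphic_on ball 0 1"
      and g: "\<And>z. z \<in> punctured_disk \<Longrightarrow> \<omega> z $ k = a / z\<^sup>2 + r / z + h z"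
    using pp unfolding principal_part_def by blast
  have r: "r = of_real (Re r)"
    using residue_real[OF assms] by (simp add: complex_eq_iff)
  obtain G where G: "\<And>x. x \<in> ball 0 1 \<Longrightarrow> (G has_field_derivative h x) (at x within ball 0 1)"
    using holomorphic_convex_primitive'[OF convex_ball open_ball h] by blast
  have G': "(G has_field_derivative h x) (at x)" if "x \<in> ball 0 1" for x
    using G[OF that] that by (metis at_within_open open_ball)
  define u where "u = (\<lambda>z. f z $ k - (Re (- a / z) + Re r * ln (norm z) + Re (G z)))"
  have "u x = u y" if "x \<in> punctured_disk" "y \<in> punctured_disk" for x y
  proof (rule has_derivative_zero_unique_connected[OF open_punctured_disk connected_punctured_disk _ that])
    fix z assume z: "z \<in> punctured_disk"
    then have z0: "z \<noteq> 0" and zb: "z \<in> ball 0 1"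
      by (auto simp: punctured_disk_def)
    have 1: "((\<lambda>z. - a / z) has_derivative (\<lambda>h. a / z\<^sup>2 * h)) (at z)"
      using z0 by (auto intro!: derivative_eq_intros simp: field_simps power2_eq_square)
    have "(u has_derivative (\<lambda>e. Re (\<omega> z $ k * e) - (Re (a / z\<^sup>2 * e) + Re r * Re (e / z) + Re (h z * e)))) (at z)"
      unfolding u_def
      by (intro has_derivative_diff has_derivative_add has_derivative_of_Re_integral[OF \<omega> z]
          has_derivative_Re 1 has_derivative_mult_right has_derivative_ln_norm z0
          G'[OF zb, unfolded has_field_derivative_def])
    moreover have "Re (\<omega> z $ k * e) - (Re (a / z\<^sup>2 * e) + Re r * Re (e / z) + Re (h z * e)) = 0" for e
    proof -
      \<comment> \<open>This is where a real residue matters: only a real factor can be pulled out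
        of \<open>Re\<close>.\<close>
      have eq: "r / z * e = of_real (Re r) * (e / z)"
        using r by (metis times_divide_eq_left times_divide_eq_right)
      have "Re r * Re (e / z) = Re (r / z * e)"
        unfolding eq by (simp del: times_divide_eq_right)
      then show ?thesis
        by (simp add: g[OF z] ring_distribs)
    qed
    ultimately show "(u has_derivative (\<lambda>_. 0)) (at z)" by simp
  qed
  then obtain c where c: "\<And>z. z \<in> punctured_disk \<Longrightarrow> u z = c"
    by metis
  \<comment> \<open>The constant of integration is absorbed into the holomorphic part.\<close>
  have "(\<lambda>z. G z + of_real c) holomorphic_on ball 0 1"
    using G unfolding holomorphic_on_def[of G] field_differentiable_def
    by (intro holomorphic_intros) (meson holomorphic_on_def field_differentiable_def)
  moreover have "f z $ k = Re (- a / z) + Re r * ln (norm z) + Re (G z + of_real c)"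
    if "z \<in> punctured_disk" for z
    using c[OF that] by (simp add: u_def)
  ultimately show thesis
    using that by blast
qed

section \<open>Proper and properly embedded ends\<close>

text \<open>Writing \<open>f\<close> as an affine image of \<open>g\<close> bounds
  \<open>norm (f z)\<close> by \<open>norm (g z) * K + norm v\<close>, which forces \<open>g\<close>
  to infinity along with \<open>f\<close>.\<close>

lemma proper_end_affine:
  assumes "affinely_equivalent f g" "proper_end f"
  shows "proper_end g"
proof -
  obtain M v where M: "\<And>z. z \<in> punctured_disk \<Longrightarrow> f z = M *v g z + v"
    using affinely_equivalent_sym[OF assms(1)] unfolding affinely_equivalent_def by blast
  obtain K where K: "K > 0" "\<And>x. norm (M *v x) \<le> norm x * K"
    using bounded_linear.pos_bounded[OF matrix_vector_mul_bounded_linear[of M]] by blast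
  have "filterlim (\<lambda>z. inverse K * (- norm v + norm (f z))) at_top (at 0)"
    using assms(2) K(1) unfolding proper_end_def
    by (intro filterlim_tendsto_pos_mult_at_top[OF tendsto_const]
        filterlim_tendsto_add_at_top[OF tendsto_const]) auto
  moreover have "eventually (\<lambda>z. inverse K * (- norm v + norm (f z)) \<le> norm (g z)) (at 0)"
    using eventually_punctured_disk
  proof eventually_elim
    case (elim z)
    have "norm (f z) \<le> norm (g z) * K + norm v"
      using norm_triangle_ineq[of "M *v g z" v] K(2)[of "g z"] M[OF elim] by simp
    then show ?case
      using K(1) by (simp add: field_simps)
  qed
  ultimately show ?thesis
    unfolding proper_end_def by (rule filterlim_at_top_mono)
qed

lemma properly_embedded_end_affine:
  assumes "affinely_equivalent f g" "properly_embedded_end f"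
  shows "properly_embedded_end g"
proof -
  obtain M v where M: "invertible M" "\<And>z. z \<in> punctured_disk \<Longrightarrow> g z = M *v f z + v"
    using assms(1) unfolding affinely_equivalent_def by blast
  have injM: "inj ((*v) M)"
    using M(1) by (simp add: inj_matrix_vector_mult)
  obtain r where r: "0 < r" "r \<le> 1" "inj_on f (ball 0 r - {0})" "immersion_on f (ball 0 r - {0})"
    using assms(2) unfolding properly_embedded_end_def by blast
  have sub: "z \<in> punctured_disk" if "z \<in> ball 0 r - {0}" for z :: complex
    using that r(2) by (auto simp: punctured_disk_def)
  have "inj_on g (ball 0 r - {0})"
  proof (rule inj_onI)
    fix z w :: complex assume zw: "z \<in> ball 0 r - {0}" "w \<in> ball 0 r - {0}" "g z = g w"
    then have "M *v f z = M *v f w"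
      using M(2)[OF sub[OF zw(1)]] M(2)[OF sub[OF zw(2)]] by simp
    then have "f z = f w"
      by (rule injD[OF injM])
    then show "z = w"
      using r(3) zw(1,2) by (meson inj_onD)
  qed
  moreover have "immersion_on g (ball 0 r - {0})"
    unfolding immersion_on_def
  proof
    fix z :: complex assume z: "z \<in> ball 0 r - {0}"
    obtain D where D: "(f has_derivative D) (at z)" "inj D"
      using r(4) z unfolding immersion_on_def by blast
    have "((\<lambda>w. M *v f w + v) has_derivative (\<lambda>h. M *v D h + 0)) (at z)"
      by (intro has_derivative_add has_derivative_const
          bounded_linear.has_derivative[OF matrix_vector_mul_bounded_linear] D)
    then have "(g has_derivative (\<lambda>h. M *v D h + 0)) (at z)"
      by (rule has_derivative_transform_within_open[OF _ open_punctured_disk sub[OF z]])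
        (simp add: M(2))
    moreover have "inj (\<lambda>h. M *v D h + 0)"
      using inj_compose[OF injM D(2)] by (simp add: o_def)
    ultimately show "\<exists>D. (g has_derivative D) (at z) \<and> inj D"
      by blast
  qed
  moreover have "proper_end g"
    using assms proper_end_affine unfolding properly_embedded_end_def by blast
  ultimately show ?thesis
    using r(1,2) unfolding properly_embedded_end_def by blast
qed

lemma has_derivative_vec_of_Re_integral:
  assumes "meromorphic_forms \<omega>" "Re_integral_of \<omega> f" "z \<in> punctured_disk"
  shows "(f has_derivative (\<lambda>h. \<chi> k. Re (\<omega> z $ k * h))) (at z)"
proof (subst has_derivative_componentwise_within, rule ballI)
  fix b :: "real ^ 3" assume "b \<in> Basis"
  then obtain k where "b = axis k 1"
    by (auto simp: Basis_vec_def)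
  then show "((\<lambda>w. f w \<bullet> b) has_derivative (\<lambda>h. (\<chi> k. Re (\<omega> z $ k * h)) \<bullet> b)) (at z)"
    using has_derivative_of_Re_integral[OF assms, of k] by (simp add: inner_axis)
qed

text \<open>
  The factor \<open>norm z\<close> makes \<open>norm (f z)\<close> grow like \<open>1 / norm z\<close> for fixed \<open>w\<close>; bounded by 1, it
  leaves a lower Lipschitz bound, which makes \<open>f\<close> injective and every derivative injective.
\<close>

lemma properly_embedded_endI:
  fixes f :: "complex \<Rightarrow> real ^ 3"
  assumes diff: "\<And>z. z \<in> punctured_disk \<Longrightarrow> f differentiable (at z)"
    and \<delta>: "0 < \<delta>" "\<delta> \<le> 1"
    and expand: "\<And>z w. 0 < norm z \<Longrightarrow> norm z \<le> norm w \<Longrightarrow> norm w < \<delta> \<Longrightarrow>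
      norm (z - w) \<le> norm z * norm (f z - f w)"
  shows "properly_embedded_end f"
proof -
  have expand': "norm (z - w) \<le> norm (f z - f w)"
    if "0 < norm z" "0 < norm w" "norm z < \<delta>" "norm w < \<delta>" for z w :: complex
  proof (cases "norm z \<le> norm w")
    case True
    have "norm z * norm (f z - f w) \<le> 1 * norm (f z - f w)"
      using that \<delta> by (intro mult_right_mono) auto
    then show ?thesis using expand[of z w] True that by simp
  next
    case False
    have "norm w * norm (f w - f z) \<le> 1 * norm (f w - f z)"
      using that \<delta> by (intro mult_right_mono) auto
    then show ?thesis using expand[of w z] False that by (simp add: norm_minus_commute)
  qed
  have "inj_on f (ball 0 \<delta> - {0})"
  proof (rule inj_onI)
    fix z w :: complex assume "z \<in> ball 0 \<delta> - {0}" "w \<in> ball 0 \<delta> - {0}" "f z = f w"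
    then show "z = w" using expand'[of z w] by simp
  qed
  moreover have "immersion_on f (ball 0 \<delta> - {0})"
    unfolding immersion_on_def
  proof
    fix z :: complex assume z: "z \<in> ball 0 \<delta> - {0}"
    then have "z \<in> punctured_disk" using \<delta> by (auto simp: punctured_disk_def)
    then obtain D where D: "(f has_derivative D) (at z)"
      using diff unfolding differentiable_def by blast
    have linD: "linear D" using D has_derivative_linear by blast
    have "h = 0" if h: "D h = 0" for h
    proof (rule ccontr)
      assume "h \<noteq> 0"
      \<comment> \<open>With error constant 1/2, a step in a kernel direction of \<open>D\<close>
        would move \<open>f\<close> by at most half its length, against the lower Lipschitz bound
        with constant 1.\<close>
      obtain d where d: "d > 0"
          "\<And>y. norm (y - z) < d \<Longrightarrow> norm (f y - f z - D (y - z)) \<le> 1/2 * norm (y - z)"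
        using D unfolding has_derivative_at_alt by (metis half_gt_zero_iff zero_less_one)
      \<comment> \<open>The step stays where the estimate holds, away from 0 and inside radius
        \<open>\<delta>\<close>; halving makes the inequalities strict.\<close>
      define s where "s = min d (min (norm z) (\<delta> - norm z)) / 2"
      have s: "0 < s" "s < d" "s < norm z" "s < \<delta> - norm z"
        using d(1) z unfolding s_def by (auto simp: min_def)
      define y where "y = z + (s / norm h) *\<^sub>R h"
      have ny: "norm (y - z) = s"
        using s(1) \<open>h \<noteq> 0\<close> by (simp add: y_def)
      have "D (y - z) = 0"
        using linD h by (simp add: y_def linear_scale)
      then have "norm (f y - f z) \<le> 1/2 * s"
        using d(2)[of y] ny s(2) by simp
      moreover have "norm (y - z) \<le> norm (f y - f z)"
      proof (rule expand')
        show "0 < norm y" "norm y < \<delta>"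
          using norm_triangle_ineq3[of y z] ny s by linarith+
      qed (use z in auto)
      ultimately show False
        using ny s(1) by simp
    qed
    then have "inj D"
      using linD linear_injective_0 by blast
    then show "\<exists>D. (f has_derivative D) (at z) \<and> inj D"
      using D by blast
  qed
  moreover have "proper_end f"
  proof -
    \<comment> \<open>A fixed reference point, at distance at least \<open>\<delta> / 4\<close> from
      every \<open>z\<close> with \<open>norm z < \<delta> / 4\<close>.\<close>
    define w :: complex where "w = of_real (\<delta> / 2)"
    have w: "norm w = \<delta> / 2"
      using \<delta>(1) by (simp add: w_def)
    have "((\<lambda>z::complex. norm z) \<longlongrightarrow> 0) (at 0)"
      by (rule tendsto_eq_intros) auto
    then have "filterlim (\<lambda>z::complex. inverse (norm z)) at_top (at 0)"
      by (rule filterlim_inverse_at_top) (auto simp: eventually_at_filter)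
    then have "filterlim (\<lambda>z::complex. - norm (f w) + \<delta> / 4 * inverse (norm z)) at_top (at 0)"
      using \<delta>(1) by (intro filterlim_tendsto_add_at_top[OF tendsto_const]
        filterlim_tendsto_pos_mult_at_top[OF tendsto_const]) auto
    moreover have "eventually (\<lambda>z. z \<in> ball 0 (\<delta> / 4) - {0}) (at (0::complex))"
      using \<delta>(1) by (intro eventually_at_in_open) auto
    then have "eventually (\<lambda>z. - norm (f w) + \<delta> / 4 * inverse (norm z) \<le> norm (f z)) (at 0)"
    proof eventually_elim
      case (elim z)
      then have z: "0 < norm z" "norm z < \<delta> / 4" by auto
      have "\<delta> / 4 \<le> norm (z - w)"
        using norm_triangle_ineq3[of z w] w z by linarith
      also have "\<dots> \<le> norm z * norm (f z - f w)"
        using z w \<delta> by (intro expand) auto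
      finally have "\<delta> / 4 * inverse (norm z) \<le> norm (f z - f w)"
        using z by (simp add: field_simps)
      then show ?case
        using norm_triangle_ineq4[of "f z" "f w"] by linarith
    qed
    ultimately show ?thesis
      unfolding proper_end_def by (rule filterlim_at_top_mono)
  qed
  ultimately show ?thesis
    using \<delta> unfolding properly_embedded_end_def by blast
qed

text \<open>The derivative is bounded on the compact disc of radius 1/2, and convexity turns this
  bound into a Lipschitz constant.\<close>

lemma holomorphic_lipschitz_half_disk:
  assumes "H holomorphic_on ball 0 1"
  obtains B where "B \<ge> 0"
    and "\<And>z w. norm z \<le> 1/2 \<Longrightarrow> norm w \<le> 1/2 \<Longrightarrow> norm (H z - H w) \<le> B * norm (z - w)"
proof -
  have sub: "cball 0 (1/2) \<subseteq> ball (0::complex) 1" by auto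
  have "deriv H holomorphic_on ball 0 1"
    using assms by (rule holomorphic_deriv) simp
  then have "continuous_on (cball 0 (1/2)) (deriv H)"
    using sub holomorphic_on_imp_continuous_on holomorphic_on_subset by blast
  then have "bounded (deriv H ` cball 0 (1/2))"
    by (intro compact_imp_bounded compact_continuous_image) auto
  then obtain B where B: "B > 0" "\<And>z. z \<in> cball 0 (1/2) \<Longrightarrow> norm (deriv H z) \<le> B"
    by (auto simp: bounded_pos)
  have "norm (H z - H w) \<le> B * norm (z - w)" if "norm z \<le> 1/2" "norm w \<le> 1/2" for z w
  proof (rule field_differentiable_bound[of "cball 0 (1/2)" H "deriv H"])
    show "(H has_field_derivative deriv H x) (at x within cball 0 (1/2))" if "x \<in> cball 0 (1/2)" for x
      using holomorphic_derivI[OF assms open_ball] that sub has_field_derivative_at_within by blast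
  qed (use B that in auto)
  then show thesis
    using that B(1) by (meson less_imp_le)
qed

text \<open>By \<open>span\<close> the real-linear map \<open>T\<close> is injective, hence bounded
  below by some \<open>b > 0\<close>. Let \<open>s = norm (z - w)\<close> and multiply by the
  smaller modulus \<open>norm z\<close>: the pole term then changes by at least
  \<open>b * s / norm w\<close>, the logarithm by at most \<open>s * norm \<rho>\<close>, the smooth
  part by at most \<open>L * s\<close>. For small \<open>norm w\<close> the pole term wins.\<close>

lemma properly_embedded_end_normal_form:
  fixes A :: "complex ^ 3" and \<rho> :: "real ^ 3"
  assumes diff: "\<And>z. z \<in> punctured_disk \<Longrightarrow> f differentiable (at z)"
    and span: "\<And>u. (\<And>k. Re (A $ k * u) = 0) \<Longrightarrow> u = 0"
    and hol: "\<And>k. H k holomorphic_on ball 0 1"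
    and f: "\<And>z k. z \<in> punctured_disk \<Longrightarrow>
      f z $ k = Re (- (A $ k) / z) + \<rho> $ k * ln (norm z) + Re (H k z)"
  shows "properly_embedded_end f"
proof -
  define T where "T = (\<lambda>u. (\<chi> k. Re (A $ k * u)) :: real ^ 3)"
  have linT: "linear T"
    by (rule linearI) (auto simp: T_def vec_eq_iff algebra_simps)
  moreover have "inj T"
    unfolding linear_injective_0[OF linT] using span by (simp add: T_def vec_eq_iff)
  ultimately obtain b where b: "b > 0" "\<And>u. b * norm u \<le> norm (T u)"
    using linear_inj_bounded_below_pos by blast
  define K where "K = (\<lambda>z. (\<chi> k. Re (H k z)) :: real ^ 3)"
  have "\<exists>B. \<forall>k. B k \<ge> 0 \<and> (\<forall>z w. norm z \<le> 1/2 \<longrightarrow> norm w \<le> 1/2 \<longrightarrow> norm (H k z - H k w) \<le> B k * norm (z - w))"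
    by (rule choice) (metis holomorphic_lipschitz_half_disk[OF hol])
  then obtain B where B: "\<And>k. B k \<ge> 0"
      "\<And>k z w. norm z \<le> 1/2 \<Longrightarrow> norm w \<le> 1/2 \<Longrightarrow> norm (H k z - H k w) \<le> B k * norm (z - w)"
    by blast
  define L where "L = (\<Sum>k\<in>UNIV. B k)"
  have L: "L \<ge> 0"
    using B(1) by (simp add: L_def sum_nonneg)
  have K: "norm (K z - K w) \<le> L * norm (z - w)" if zw: "norm z \<le> 1/2" "norm w \<le> 1/2" for z w
  proof -
    have "norm (K z - K w) \<le> (\<Sum>k\<in>UNIV. \<bar>(K z - K w) $ k\<bar>)"
      by (rule norm_le_l1_cart)
    also have "\<dots> \<le> (\<Sum>k\<in>UNIV. B k * norm (z - w))"
    proof (rule sum_mono)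
      fix k
      have "\<bar>(K z - K w) $ k\<bar> = \<bar>Re (H k z - H k w)\<bar>" by (simp add: K_def)
      also have "\<dots> \<le> norm (H k z - H k w)" by (rule abs_Re_le_cmod)
      also have "\<dots> \<le> B k * norm (z - w)" by (rule B(2)[OF zw])
      finally show "\<bar>(K z - K w) $ k\<bar> \<le> B k * norm (z - w)" .
    qed
    finally show ?thesis by (simp add: L_def sum_distrib_right)
  qed
  \<comment> \<open>The summand 1 is what remains for \<open>norm (z - w)\<close> after the
    logarithmic and smooth errors are subtracted; \<open>\<delta> * C \<le> b\<close> makes the pole
    term at least \<open>C * s\<close>.\<close>
  define C where "C = 1 + norm \<rho> + L"
  have C: "C > 0" using L norm_ge_zero[of \<rho>] by (simp add: C_def add_pos_nonneg)
  define \<delta> where "\<delta> = min (1/2) (b / C)"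
  have \<delta>: "0 < \<delta>" "\<delta> \<le> 1/2" "\<delta> * C \<le> b"
    using b(1) C by (auto simp: \<delta>_def min_def field_simps)
  show ?thesis
  proof (rule properly_embedded_endI[OF diff])
    fix z w :: complex
    assume zw: "0 < norm z" "norm z \<le> norm w" "norm w < \<delta>"
    have pd: "z \<in> punctured_disk" "w \<in> punctured_disk"
      using zw \<delta>(2) by (auto simp: punctured_disk_def)
    define s where "s = norm (z - w)"
    have s0: "s \<ge> 0" by (simp add: s_def)
    have T1: "T (1 / x) $ k = Re (A $ k / x)" for x k
      by (simp add: T_def del: times_complex.sel)
    have eq: "f z - f w = (ln (norm z) - ln (norm w)) *\<^sub>R \<rho> + (K z - K w) - T (1 / z - 1 / w)"
      unfolding linear_diff[OF linT]
      by (simp add: vec_eq_iff f[OF pd(1)] f[OF pd(2)] K_def T1 left_diff_distrib)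
    have "norm (T (1 / z - 1 / w)) \<le> norm (f z - f w) + \<bar>ln (norm z) - ln (norm w)\<bar> * norm \<rho> + L * s"
    proof -
      have "T (1 / z - 1 / w) = (ln (norm z) - ln (norm w)) *\<^sub>R \<rho> + (K z - K w) - (f z - f w)"
        unfolding eq by simp
      then have "norm (T (1 / z - 1 / w)) \<le>
          norm ((ln (norm z) - ln (norm w)) *\<^sub>R \<rho>) + norm (K z - K w) + norm (f z - f w)"
        by (simp only: norm_triangle_le_diff norm_triangle_ineq add_right_mono)
      then show ?thesis
        using K[of z w] zw \<delta>(2) by (simp add: s_def)
    qed
    then have 1: "norm z * (b * norm (1 / z - 1 / w)) \<le>
        norm z * (norm (f z - f w) + \<bar>ln (norm z) - ln (norm w)\<bar> * norm \<rho> + L * s)"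
      using b(2)[of "1 / z - 1 / w"] by (intro mult_left_mono) auto
    have "z \<noteq> 0" "w \<noteq> 0"
      using pd by (auto simp: punctured_disk_def)
    have "norm (1 / z - 1 / w) = s / (norm z * norm w)"
    proof -
      have "1 / z - 1 / w = (w - z) / (z * w)"
        using \<open>z \<noteq> 0\<close> \<open>w \<noteq> 0\<close> by (simp add: field_simps)
      then show ?thesis
        by (simp add: s_def norm_divide norm_mult norm_minus_commute)
    qed
    then have 2: "norm z * (b * norm (1 / z - 1 / w)) = b * s / norm w"
      using zw by simp
    have "C * s * norm w \<le> b * s"
    proof -
      have "norm w * C \<le> \<delta> * C"
        using zw C by (intro mult_right_mono) auto
      then have "(norm w * C) * s \<le> b * s"
        using \<delta>(3) s0 by (intro mult_right_mono) auto
      then show ?thesis by (simp add: ac_simps)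
    qed
    then have 3: "C * s \<le> b * s / norm w"
      using \<open>w \<noteq> 0\<close> by (simp add: field_simps)
    \<comment> \<open>The inequality \<open>ln t \<le> t - 1\<close> at
      \<open>t = norm w / norm z\<close>, with the denominator cleared by the factor
      \<open>norm z\<close>.\<close>
    have "norm z * \<bar>ln (norm z) - ln (norm w)\<bar> \<le> s"
    proof -
      have "ln (norm w / norm z) \<le> norm w / norm z - 1"
        using \<open>z \<noteq> 0\<close> \<open>w \<noteq> 0\<close> by (intro ln_le_minus_one) simp
      then have "norm z * (ln (norm w) - ln (norm z)) \<le> norm w - norm z"
        using zw \<open>w \<noteq> 0\<close> by (simp add: ln_div field_simps)
      moreover have "norm w - norm z \<le> s"
        unfolding s_def by (metis norm_minus_commute norm_triangle_ineq2)
      moreover have "ln (norm z) \<le> ln (norm w)"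
        using zw \<open>w \<noteq> 0\<close> by simp
      ultimately show ?thesis by simp
    qed
    then have 4: "norm z * \<bar>ln (norm z) - ln (norm w)\<bar> * norm \<rho> \<le> s * norm \<rho>"
      by (rule mult_right_mono) simp
    have 5: "norm z * (L * s) \<le> 1 * (L * s)"
      using zw \<delta> L s0 by (intro mult_right_mono) auto
    have "C * s = s + s * norm \<rho> + L * s"
      by (simp add: C_def algebra_simps)
    then show "norm (z - w) \<le> norm z * norm (f z - f w)"
      using 1 2 3 4 5 by (simp add: s_def algebra_simps)
  qed (use \<delta> in auto)
qed

text \<open>On the circle of radius \<open>x\<close> the pole term takes every value of modulus at
  most \<open>norm a / x\<close>, which near 0 exceeds the logarithmic term. So some point of each
  small circle cancels the two, with \<open>c x\<close> the required cosine, and along these points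
  \<open>f\<close> has a finite limit.\<close>

lemma not_proper_end_normal_form:
  fixes f :: "complex \<Rightarrow> real ^ 3"
  assumes a: "a \<noteq> 0" and hol: "\<And>k. H k holomorphic_on ball 0 1"
    and f: "\<And>z k. z \<in> punctured_disk \<Longrightarrow> k \<noteq> 3 \<Longrightarrow> f z $ k = Re (H k z)"
      "\<And>z. z \<in> punctured_disk \<Longrightarrow> f z $ 3 = Re (- a / z) + \<rho> * ln (norm z) + Re (H 3 z)"
  shows "\<not> proper_end f"
proof
  assume "proper_end f"
  \<comment> \<open>\<open>Z x\<close> is the point of modulus \<open>x\<close> at which the pole term \<open>Re (- a / z)\<close> cancels the logarithm.\<close>
  define c where "c = (\<lambda>x. - \<rho> * (x * ln x) / norm a)"
  define Z where "Z = (\<lambda>x. of_real x * (sgn (- a) * cis (- arccos (c x))))"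
  \<comment> \<open>This limit brings \<open>c x\<close> into the range -1 to 1 for small
    \<open>x\<close>, where \<open>arccos\<close> inverts the cosine.\<close>
  have "((\<lambda>x::real. x * ln x) \<longlongrightarrow> 0) (at_right 0)"
    unfolding filterlim_at_right_to_top
  proof (rule Lim_transform_eventually)
    show "((\<lambda>x::real. - (ln x / x)) \<longlongrightarrow> 0) at_top"
      using tendsto_minus[OF ln_x_over_x_tendsto_0] by simp
    show "eventually (\<lambda>x::real. - (ln x / x) = inverse x * ln (inverse x)) at_top"
      using eventually_gt_at_top[of 0] by eventually_elim (simp add: ln_inverse divide_inverse mult.commute)
  qed
  then have "(c \<longlongrightarrow> - \<rho> * 0 / norm a) (at_right 0)"
    unfolding c_def using a by (intro tendsto_intros) auto
  then have "eventually (\<lambda>x. dist (c x) 0 < 1) (at_right 0)"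
    by (intro tendstoD) auto
  then have small: "eventually (\<lambda>x. \<bar>c x\<bar> \<le> 1 \<and> 0 < x \<and> x < 1) (at_right 0)"
    using eventually_at_right_real[OF zero_less_one] by eventually_elim auto
  have normZ: "norm (Z x) = x" if "0 < x" for x
    using that a by (simp add: Z_def norm_mult norm_sgn)
  define K where "K = (\<lambda>z. (\<chi> k. Re (H k z)) :: real ^ 3)"
  have fZ: "f (Z x) = K (Z x)" if x: "\<bar>c x\<bar> \<le> 1" "0 < x" "x < 1" for x
  proof -
    have Zx: "Z x \<in> punctured_disk"
      unfolding punctured_disk_def mem_Collect_eq normZ[OF x(2)] using x by simp
    define u where "u = sgn (- a)"
    have u: "u \<noteq> 0" "- a = of_real (norm a) * u"
      using a by (simp_all add: u_def sgn_div_norm scaleR_conv_of_real)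
    have "cis (- arccos (c x)) = 1 / cis (arccos (c x))"
      by (simp add: divide_inverse)
    then have "- a / Z x = of_real (norm a) * u / (of_real x * (u * (1 / cis (arccos (c x)))))"
      unfolding Z_def u_def[symmetric] using u(2) by simp
    also have "\<dots> = of_real (norm a / x) * cis (arccos (c x))"
      using u(1) x by simp
    finally have eq: "- a / Z x = of_real (norm a / x) * cis (arccos (c x))" .
    have "Re (- a / Z x) = norm a / x * c x"
      unfolding eq using x by (simp add: cos_arccos_abs del: of_real_divide)
    then have "Re (- a / Z x) + \<rho> * ln (norm (Z x)) = 0"
      using a x by (simp add: normZ c_def)
    then show ?thesis
      using f(1)[OF Zx] f(2)[OF Zx] unfolding K_def vec_eq_iff
      by (metis add_0 vec_lambda_beta)
  qed
  have limZ: "(Z \<longlongrightarrow> 0) (at_right 0)"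
  proof (rule tendsto_norm_zero_cancel, rule Lim_transform_eventually)
    show "((\<lambda>x::real. x) \<longlongrightarrow> 0) (at_right 0)"
      by (rule tendsto_ident_at)
    show "eventually (\<lambda>x. x = norm (Z x)) (at_right 0)"
      using eventually_at_right_less[of "0::real"] by eventually_elim (simp add: normZ)
  qed
  have "isCont (H k) 0" for k
    using holomorphic_on_imp_continuous_on[OF hol] by (rule continuous_on_interior) simp
  then have "isCont K 0"
    unfolding K_def isCont_def by (intro vec_tendstoI) (simp add: tendsto_Re)
  then have "((\<lambda>x. K (Z x)) \<longlongrightarrow> K 0) (at_right 0)"
    using limZ by (rule isCont_tendsto_compose)
  then have "((\<lambda>x. f (Z x)) \<longlongrightarrow> K 0) (at_right 0)"
    by (rule Lim_transform_eventually) (use small in \<open>eventually_elim, simp add: fZ\<close>)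
  \<comment> \<open>The curve tends to 0 without meeting it, so properness would send
    \<open>f (Z x)\<close> to infinity.\<close>
  moreover have "filterlim Z (at 0) (at_right 0)"
    unfolding filterlim_at using limZ small
    by (auto elim!: eventually_mono) (metis less_irrefl normZ norm_zero)
  then have "filterlim (\<lambda>x. norm (f (Z x))) at_top (at_right 0)"
    using \<open>proper_end f\<close> unfolding proper_end_def by (rule filterlim_compose[rotated])
  then have "filterlim (\<lambda>x. f (Z x)) at_infinity (at_right 0)"
    by (simp add: filterlim_norm_at_top_imp_at_infinity)
  ultimately show False
    using not_tendsto_and_filterlim_at_infinity[OF trivial_limit_at_right_real] by blast
qed

section \<open>Reduced forms\<close>

definition principal_orders :: "complex ^ 3 \<Rightarrow> complex ^ 3 \<Rightarrow> nat \<times> nat \<times> nat" where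
  "principal_orders A R =
     (principal_order (A $ 1) (R $ 1), principal_order (A $ 2) (R $ 2), principal_order (A $ 3) (R $ 3))"

text \<open>Written with \<open>Suc 0\<close>, the simp normal form of 1; the strict inequalities
  serve the lexicographic comparisons.\<close>

lemma principal_order_iff [simp]:
  "principal_order a r = 0 \<longleftrightarrow> a = 0 \<and> r = 0"
  "principal_order a r = Suc 0 \<longleftrightarrow> a = 0 \<and> r \<noteq> 0"
  "principal_order a r = 2 \<longleftrightarrow> a \<noteq> 0"
  "principal_order a r < Suc 0 \<longleftrightarrow> a = 0 \<and> r = 0"
  "principal_order a r < 2 \<longleftrightarrow> a = 0"
  by (auto simp: principal_order_def)

abbreviation triple_less :: "((nat \<times> nat \<times> nat) \<times> (nat \<times> nat \<times> nat)) set" where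
  "triple_less \<equiv> less_than <*lex*> less_than <*lex*> less_than"

lemma principal_part_cong:
  assumes "principal_part g a r" "\<And>z. z \<in> punctured_disk \<Longrightarrow> g z = g' z"
  shows "principal_part g' a r"
  using assms unfolding principal_part_def by auto

text \<open>Since the forms of an end are unique on the punctured disk, any one choice of forms
  computes the pole orders.\<close>

lemma has_pole_orders_iff:
  assumes \<omega>: "meromorphic_forms \<omega>" "Re_integral_of \<omega> f"
    and pp: "\<And>k. principal_part (\<lambda>z. \<omega> z $ k) (A $ k) (R $ k)"
  shows "has_pole_orders f n \<longleftrightarrow> n = principal_orders A R"
proof
  assume "has_pole_orders f n"
  then obtain \<eta> where \<eta>: "meromorphic_forms \<eta>" "Re_integral_of \<eta> f"
      "n = (pole_order (\<lambda>z. \<eta> z $ 1), pole_order (\<lambda>z. \<eta> z $ 2), pole_order (\<lambda>z. \<eta> z $ 3))"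
    unfolding has_pole_orders_def by blast
  have "principal_part (\<lambda>z. \<eta> z $ k) (A $ k) (R $ k)" for k
    using pp by (rule principal_part_cong) (simp add: Re_integral_of_unique[OF \<omega> \<eta>(1,2)])
  then show "n = principal_orders A R"
    by (simp add: \<eta>(3) principal_orders_def pole_order_principal_part)
next
  assume "n = principal_orders A R"
  then show "has_pole_orders f n"
    using \<omega> unfolding has_pole_orders_def principal_orders_def
    by (intro exI[of _ \<omega>]) (simp add: pole_order_principal_part[OF pp])
qed

text \<open>Minimality over all affinely equivalent ends becomes a statement of linear algebra:
  invertible real matrices acting on the coefficient vectors \<open>A\<close> and
  \<open>R\<close>.\<close>

lemma reduced_form_with_iff:
  assumes \<omega>: "meromorphic_forms \<omega>" "Re_integral_of \<omega> f"
    and pp: "\<And>k. principal_part (\<lambda>z. \<omega> z $ k) (A $ k) (R $ k)"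
  shows "reduced_form_with f n \<longleftrightarrow> n = principal_orders A R \<and>
    fst n \<le> fst (snd n) \<and> fst (snd n) \<le> snd (snd n) \<and>
    (\<forall>M. invertible M \<longrightarrow> (principal_orders (transform M A) (transform M R), n) \<notin> triple_less)"
proof -
  have iff: "has_pole_orders g m \<longleftrightarrow> m = principal_orders (transform M A) (transform M R)"
    if "\<And>z. z \<in> punctured_disk \<Longrightarrow> g z = M *v f z + v" for g m M v
    using Re_integral_of_affine[OF \<omega> that] principal_part_transform[OF pp]
    by (intro has_pole_orders_iff)
  have "(\<forall>g m. affinely_equivalent f g \<and> has_pole_orders g m \<longrightarrow> (m, n) \<notin> triple_less) \<longleftrightarrow>
      (\<forall>M. invertible M \<longrightarrow> (principal_orders (transform M A) (transform M R), n) \<notin> triple_less)"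
    (is "?L \<longleftrightarrow> ?R")
  proof
    assume L: ?L
    show ?R
    proof (intro allI impI)
      fix M :: "real ^ 3 ^ 3" assume M: "invertible M"
      have "affinely_equivalent f (\<lambda>z. M *v f z + 0)"
        using M unfolding affinely_equivalent_def by blast
      moreover have "has_pole_orders (\<lambda>z. M *v f z + 0) (principal_orders (transform M A) (transform M R))"
        by (rule iff[THEN iffD2, OF refl refl])
      ultimately show "(principal_orders (transform M A) (transform M R), n) \<notin> triple_less"
        using L by blast
    qed
  next
    assume R: ?R
    show ?L
    proof (intro allI impI, elim conjE)
      fix g m assume g: "affinely_equivalent f g" "has_pole_orders g m"
      obtain M v where M: "invertible M" "\<And>z. z \<in> punctured_disk \<Longrightarrow> g z = M *v f z + v"
        using g(1) unfolding affinely_equivalent_def by blast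
      have "m = principal_orders (transform M A) (transform M R)"
        using iff[OF M(2), THEN iffD1, OF _ g(2)] by simp
      then show "(m, n) \<notin> triple_less"
        using R M(1) by blast
    qed
  qed
  then show ?thesis
    unfolding reduced_form_with_def has_pole_orders_iff[OF assms] by blast
qed

lemma transform_nth:
  "transform M c $ k = of_real (M $ k $ 1) * c $ 1 + of_real (M $ k $ 2) * c $ 2 + of_real (M $ k $ 3) * c $ 3"
  by (simp add: transform_def sum_3)

text \<open>The expression is, up to sign, the determinant of \<open>A $ 2\<close> and
  \<open>A $ 3\<close> as vectors of the real plane. If it vanished, a real multiple of coordinate 2
  could be subtracted from coordinate 3 to cancel the double pole; exchanging the two coordinates
  would then lower the second order.\<close>

lemma reduced_independent:
  assumes n: "principal_orders A R = (n1, 2, 2)"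
    and min: "\<And>M. invertible M \<Longrightarrow>
      (principal_orders (transform M A) (transform M R), principal_orders A R) \<notin> triple_less"
  shows "Im (A $ 2 * cnj (A $ 3)) \<noteq> 0"
proof
  assume *: "Im (A $ 2 * cnj (A $ 3)) = 0"
  have A2: "A $ 2 \<noteq> 0" and A3: "A $ 3 \<noteq> 0"
    using n by (auto simp: principal_orders_def split: if_splits)
  define t where "t = Re (A $ 3 / A $ 2)"
  have "Im (A $ 3 / A $ 2) = 0"
    using * by (simp add: Im_divide algebra_simps)
  then have "A $ 3 / A $ 2 = of_real t"
    by (simp add: t_def complex_eq_iff)
  then have t: "A $ 3 = of_real t * A $ 2"
    using A2 by (simp add: field_simps)
  define M :: "real ^ 3 ^ 3" where
    "M = vector [vector [1, 0, 0], vector [0, - t, 1], vector [0, 1, 0]]"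
  have "invertible M"
    by (simp add: invertible_det_nz det_3 M_def)
  moreover have "(principal_orders (transform M A) (transform M R), principal_orders A R) \<in> triple_less"
    unfolding n using n by (auto simp: principal_orders_def transform_nth M_def t)
  ultimately show False
    using min by blast
qed

text \<open>Among the sorted pairs only (1, 1) and (2, 2) must be excluded. Two real residues are
  proportional, and three vectors in the real plane are dependent; in either case a linear change
  lowers the first order.\<close>

lemma reduced_order_2_types:
  assumes n: "principal_orders A R = (n1, n2, 2)" and sorted: "n1 \<le> n2" "n2 \<le> 2"
    and real: "\<And>k. Im (R $ k) = 0"
    and min: "\<And>M. invertible M \<Longrightarrow>
      (principal_orders (transform M A) (transform M R), principal_orders A R) \<notin> triple_less"
  shows "(n1, n2) \<in> {(1, 2), (0, 2), (0, 1), (0, 0)}"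
proof -
  have "\<not> (n1 = 1 \<and> n2 = 1)"
  proof
    assume 11: "n1 = 1 \<and> n2 = 1"
    then have A: "A $ 1 = 0" "A $ 2 = 0" and R: "R $ 2 \<noteq> 0"
      using n by (simp_all add: principal_orders_def)
    define t where "t = Re (R $ 1) / Re (R $ 2)"
    have "Re (R $ 2) \<noteq> 0"
      using R real by (simp add: complex_eq_iff)
    then have t: "R $ 1 = of_real t * R $ 2"
      using real by (simp add: complex_eq_iff t_def)
    define M :: "real ^ 3 ^ 3" where
      "M = vector [vector [1, - t, 0], vector [0, 1, 0], vector [0, 0, 1]]"
    have "invertible M"
      by (simp add: invertible_det_nz det_3 M_def)
    moreover have "(principal_orders (transform M A) (transform M R), principal_orders A R) \<in> triple_less"
      unfolding n using 11 n by (simp add: principal_orders_def transform_nth M_def t A)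
    ultimately show False
      using min by blast
  qed
  moreover have "\<not> (n1 = 2 \<and> n2 = 2)"
  proof
    assume 22: "n1 = 2 \<and> n2 = 2"
    define d where "d = Im (A $ 2 * cnj (A $ 3))"
    have d: "d \<noteq> 0"
      using reduced_independent[OF _ min] n 22 unfolding d_def by auto
    \<comment> \<open>Cramer's rule for \<open>A $ 1\<close> in the real basis \<open>A $ 2\<close>,
      \<open>A $ 3\<close>, with determinant \<open>d\<close>.\<close>
    define p q where "p = Im (A $ 1 * cnj (A $ 3))" and "q = Im (A $ 2 * cnj (A $ 1))"
    have "of_real d * A $ 1 = of_real p * A $ 2 + of_real q * A $ 3"
      by (simp add: complex_eq_iff d_def p_def q_def algebra_simps)
    then have eq: "A $ 1 = of_real (p / d) * A $ 2 + of_real (q / d) * A $ 3"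
      using d by (simp add: field_simps)
    define M :: "real ^ 3 ^ 3" where
      "M = vector [vector [1, - (p / d), - (q / d)], vector [0, 1, 0], vector [0, 0, 1]]"
    have "invertible M"
      by (simp add: invertible_det_nz det_3 M_def)
    moreover have "(principal_orders (transform M A) (transform M R), principal_orders A R) \<in> triple_less"
      unfolding n using 22 by (simp add: principal_orders_def transform_nth M_def eq)
    ultimately show False
      using min by blast
  qed
  ultimately show ?thesis
    using sorted by auto
qed

section \<open>Ends of order 2: possible types and their properties\<close>

text \<open>Unpacks the definite description in \<open>end_type\<close> once: a reduced
  representative \<open>g\<close> with its coefficients. The equivalence runs from \<open>g\<close>
  to \<open>f\<close>, the direction in which embeddedness is carried back.\<close>

lemma meromorphic_end_of_order_2:
  assumes "meromorphic_end f" "end_order f = 2"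
  obtains g \<omega> A R where "affinely_equivalent g f" "meromorphic_forms \<omega>" "Re_integral_of \<omega> g"
    "\<And>k. principal_part (\<lambda>z. \<omega> z $ k) (A $ k) (R $ k)"
    "end_type f = principal_orders A R"
    "\<And>M. invertible M \<Longrightarrow>
      (principal_orders (transform M A) (transform M R), principal_orders A R) \<notin> triple_less"
    "fst (end_type f) \<le> fst (snd (end_type f))" "fst (snd (end_type f)) \<le> 2"
proof -
  obtain g where g: "affinely_equivalent f g" "reduced_form_with g (end_type f)"
    using theI'[OF ex1_end_type[OF assms(1)]] unfolding end_type_def by blast
  obtain \<omega> where \<omega>: "meromorphic_forms \<omega>" "Re_integral_of \<omega> g"
      "end_type f = (pole_order (\<lambda>z. \<omega> z $ 1), pole_order (\<lambda>z. \<omega> z $ 2), pole_order (\<lambda>z. \<omega> z $ 3))"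
    using g(2) unfolding reduced_form_with_def has_pole_orders_def by blast
  have sorted: "fst (end_type f) \<le> fst (snd (end_type f))" "fst (snd (end_type f)) \<le> snd (snd (end_type f))"
    using g(2) unfolding reduced_form_with_def by blast+
  \<comment> \<open>The largest order is 2 and the orders are sorted, so the expansion into
    principal parts is available for all three forms.\<close>
  have "pole_order (\<lambda>z. \<omega> z $ k) \<le> 2" for k
    using assms(2) sorted exhaust_3[of k] unfolding end_order_def \<omega>(3) by auto
  then have "\<exists>a r. principal_part (\<lambda>z. \<omega> z $ k) a r" for k
    using \<omega>(1) unfolding meromorphic_forms_def by (intro principal_part_exists) auto
  then obtain a r where "\<And>k. principal_part (\<lambda>z. \<omega> z $ k) (a k) (r k)"
    by metis
  then have pp: "principal_part (\<lambda>z. \<omega> z $ k) ((\<chi> k. a k) $ k) ((\<chi> k. r k) $ k)" for k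
    by simp
  note iff = reduced_form_with_iff[OF \<omega>(1,2) pp, THEN iffD1, OF g(2)]
  show thesis
  proof (rule that[OF affinely_equivalent_sym[OF g(1)] \<omega>(1,2) pp])
    show "end_type f = principal_orders (\<chi> k. a k) (\<chi> k. r k)"
      using iff by blast
    then show "(principal_orders (transform M (\<chi> k. a k)) (transform M (\<chi> k. r k)),
        principal_orders (\<chi> k. a k) (\<chi> k. r k)) \<notin> triple_less" if "invertible M" for M
      using iff that by metis
    show "fst (end_type f) \<le> fst (snd (end_type f))" "fst (snd (end_type f)) \<le> 2"
      using sorted assms(2) by (simp_all add: end_order_def)
  qed
qed

lemma end_type_of_order_2:
  assumes "meromorphic_end f" "end_order f = 2"
  shows "end_type f \<in> {(1, 2, 2), (0, 2, 2), (0, 1, 2), (0, 0, 2)}"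
proof -
  obtain g \<omega> A R where g: "affinely_equivalent g f" "meromorphic_forms \<omega>" "Re_integral_of \<omega> g"
    "\<And>k. principal_part (\<lambda>z. \<omega> z $ k) (A $ k) (R $ k)"
    "end_type f = principal_orders A R"
    "\<And>M. invertible M \<Longrightarrow>
      (principal_orders (transform M A) (transform M R), principal_orders A R) \<notin> triple_less"
    "fst (end_type f) \<le> fst (snd (end_type f))" "fst (snd (end_type f)) \<le> 2"
    using meromorphic_end_of_order_2[OF assms] by blast
  obtain n1 n2 where n: "end_type f = (n1, n2, 2)"
    using assms(2) unfolding end_order_def by (metis prod.collapse)
  have "(n1, n2) \<in> {(1, 2), (0, 2), (0, 1), (0, 0)}"
  proof (rule reduced_order_2_types[OF _ _ _ residue_real[OF g(2,3,4)] g(6)])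
    show "principal_orders A R = (n1, n2, 2)"
      using n g(5) by simp
    show "n1 \<le> n2" "n2 \<le> 2"
      using g(7,8) n by simp_all
  qed
  then show ?thesis
    using n by auto
qed

text \<open>Treats catenoidal and planar ends together, through the independence of
  \<open>A $ 2\<close> and \<open>A $ 3\<close> over the reals.\<close>

lemma properly_embedded_end_type_n_2_2:
  assumes "meromorphic_end f" "end_type f = (n, 2, 2)"
  shows "properly_embedded_end f"
proof -
  have "end_order f = 2"
    using assms(2) by (simp add: end_order_def)
  then obtain g \<omega> A R where g: "affinely_equivalent g f" "meromorphic_forms \<omega>" "Re_integral_of \<omega> g"
    "\<And>k. principal_part (\<lambda>z. \<omega> z $ k) (A $ k) (R $ k)"
    "end_type f = principal_orders A R"
    "\<And>M. invertible M \<Longrightarrow>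
      (principal_orders (transform M A) (transform M R), principal_orders A R) \<notin> triple_less"
    using meromorphic_end_of_order_2[OF assms(1)] by metis
  have "\<exists>H. H holomorphic_on ball 0 1 \<and> (\<forall>z\<in>punctured_disk.
      g z $ k = Re (- (A $ k) / z) + Re (R $ k) * ln (norm z) + Re (H z))" for k
    using end_normal_form[OF g(2,3,4)] by metis
  then obtain H where H: "\<And>k. H k holomorphic_on ball 0 1"
      "\<And>z k. z \<in> punctured_disk \<Longrightarrow>
        g z $ k = Re (- (A $ k) / z) + Re (R $ k) * ln (norm z) + Re (H k z)"
    by metis
  have d: "Im (A $ 2 * cnj (A $ 3)) \<noteq> 0"
    using g(5) assms(2) by (intro reduced_independent[OF _ g(6), of n]) simp_all
  have "properly_embedded_end g"
  proof (rule properly_embedded_end_normal_form[of g A H "\<chi> k. Re (R $ k)"])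
    show "g differentiable (at z)" if "z \<in> punctured_disk" for z
      using has_derivative_vec_of_Re_integral[OF g(2,3) that] unfolding differentiable_def by blast
    show "u = 0" if u: "\<And>k. Re (A $ k * u) = 0" for u
    proof -
      \<comment> \<open>Cramer's rule again, now solving
        \<open>Re (A $ 2 * u) = Re (A $ 3 * u) = 0\<close> for \<open>Re u\<close> and
        \<open>Im u\<close>.\<close>
      have "Im (A $ 2 * cnj (A $ 3)) * Re u = Im (A $ 2) * Re (A $ 3 * u) - Im (A $ 3) * Re (A $ 2 * u)"
        "Im (A $ 2 * cnj (A $ 3)) * Im u = Re (A $ 2) * Re (A $ 3 * u) - Re (A $ 3) * Re (A $ 2 * u)"
        by (simp_all add: algebra_simps)
      then show "u = 0"
        using d u by (simp add: complex_eq_iff del: times_complex.sel)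
    qed
  qed (use H in auto)
  then show ?thesis
    by (rule properly_embedded_end_affine[OF g(1)])
qed

lemma not_proper_end_type_0_0_2:
  assumes "meromorphic_end f" "end_type f = (0, 0, 2)"
  shows "\<not> proper_end f"
proof -
  have "end_order f = 2"
    using assms(2) by (simp add: end_order_def)
  then obtain g \<omega> A R where g: "affinely_equivalent g f" "meromorphic_forms \<omega>" "Re_integral_of \<omega> g"
    "\<And>k. principal_part (\<lambda>z. \<omega> z $ k) (A $ k) (R $ k)"
    "end_type f = principal_orders A R"
    using meromorphic_end_of_order_2[OF assms(1)] by metis
  have "\<exists>H. H holomorphic_on ball 0 1 \<and> (\<forall>z\<in>punctured_disk.
      g z $ k = Re (- (A $ k) / z) + Re (R $ k) * ln (norm z) + Re (H z))" for k
    using end_normal_form[OF g(2,3,4)] by metis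
  then obtain H where H: "\<And>k. H k holomorphic_on ball 0 1"
      "\<And>z k. z \<in> punctured_disk \<Longrightarrow>
        g z $ k = Re (- (A $ k) / z) + Re (R $ k) * ln (norm z) + Re (H k z)"
    by metis
  have AR: "A $ 1 = 0" "R $ 1 = 0" "A $ 2 = 0" "R $ 2 = 0" "A $ 3 \<noteq> 0"
    using g(5) assms(2) by (auto simp: principal_orders_def split: if_splits)
  have "\<not> proper_end g"
  proof (rule not_proper_end_normal_form[OF AR(5) H(1)])
    show "g z $ k = Re (H k z)" if "z \<in> punctured_disk" "k \<noteq> 3" for z k
      using H(2)[OF that(1), of k] that(2) exhaust_3[of k] AR by auto
  qed (use H(2) in blast)
  then show ?thesis
    using proper_end_affine[OF affinely_equivalent_sym[OF g(1)]] by blast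
qed

section \<open>Examples\<close>

text \<open>The normal form with a linear holomorphic part. The coefficient \<open>E\<close> can
  make a coordinate of pole order 0 nonconstant, which the example of type (0, 1, 2) uses to
  separate points.\<close>

definition model_end :: "complex ^ 3 \<Rightarrow> real ^ 3 \<Rightarrow> complex ^ 3 \<Rightarrow> complex \<Rightarrow> real ^ 3" where
  "model_end A \<rho> E z = (\<chi> k. Re (- (A $ k) / z) + \<rho> $ k * ln (norm z) + Re (E $ k * z))"

definition model_forms :: "complex ^ 3 \<Rightarrow> real ^ 3 \<Rightarrow> complex ^ 3 \<Rightarrow> complex \<Rightarrow> complex ^ 3" where
  "model_forms A \<rho> E z = (\<chi> k. A $ k / z\<^sup>2 + of_real (\<rho> $ k) / z + E $ k)"

lemma model_end_forms:
  shows "meromorphic_forms (model_forms A \<rho> E)"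
    and "Re_integral_of (model_forms A \<rho> E) (model_end A \<rho> E)"
    and "principal_part (\<lambda>z. model_forms A \<rho> E z $ k) (A $ k) ((\<chi> k. of_real (\<rho> $ k)) $ k)"
proof -
  have hol: "(\<lambda>z. model_forms A \<rho> E z $ k) holomorphic_on punctured_disk" for k
    by (auto simp: model_forms_def punctured_disk_def intro!: holomorphic_intros)
  then show "meromorphic_forms (model_forms A \<rho> E)"
    unfolding meromorphic_forms_def by (auto simp: model_forms_def intro!: meromorphic_intros)
  show "principal_part (\<lambda>z. model_forms A \<rho> E z $ k) (A $ k) ((\<chi> k. of_real (\<rho> $ k)) $ k)"
    unfolding principal_part_def by (intro exI[of _ "\<lambda>_. E $ k"]) (simp add: model_forms_def)
  show "Re_integral_of (model_forms A \<rho> E) (model_end A \<rho> E)"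
  proof (rule Re_integral_ofI[OF hol])
    fix z k assume "z \<in> punctured_disk"
    then have z: "z \<noteq> 0" by (auto simp: punctured_disk_def)
    have 1: "((\<lambda>z. - (A $ k) / z) has_derivative (\<lambda>h. A $ k / z\<^sup>2 * h)) (at z)"
      using z by (auto intro!: derivative_eq_intros simp: field_simps power2_eq_square)
    have "((\<lambda>w. Re (- (A $ k) / w) + \<rho> $ k * ln (norm w) + Re (E $ k * w)) has_derivative
        (\<lambda>h. Re (A $ k / z\<^sup>2 * h) + \<rho> $ k * Re (h / z) + Re (E $ k * h))) (at z)"
      by (intro has_derivative_add has_derivative_Re 1 has_derivative_mult_right
          has_derivative_ln_norm z has_derivative_ident)
    moreover have "Re (model_forms A \<rho> E z $ k * h) =
        Re (A $ k / z\<^sup>2 * h) + \<rho> $ k * Re (h / z) + Re (E $ k * h)" for h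
    proof -
      have "model_forms A \<rho> E z $ k * h = A $ k / z\<^sup>2 * h + of_real (\<rho> $ k) * (h / z) + E $ k * h"
        by (simp add: model_forms_def ring_distribs)
      moreover have "Re (of_real (\<rho> $ k) * (h / z)) = \<rho> $ k * Re (h / z)"
        by (simp del: times_divide_eq_right)
      ultimately show ?thesis
        by (simp only: plus_complex.sel)
    qed
    ultimately show "((\<lambda>w. model_end A \<rho> E w $ k) has_derivative
        (\<lambda>h. Re (model_forms A \<rho> E z $ k * h))) (at z)"
      by (simp only: model_end_def vec_lambda_beta)
  qed
qed

lemma end_type_model_end:
  assumes "principal_orders A (\<chi> k. of_real (\<rho> $ k)) = n"
    "fst n \<le> fst (snd n)" "fst (snd n) \<le> snd (snd n)"
    "\<And>M. invertible M \<Longrightarrow>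
      (principal_orders (transform M A) (transform M (\<chi> k. of_real (\<rho> $ k))), n) \<notin> triple_less"
  shows "meromorphic_end (model_end A \<rho> E) \<and> end_type (model_end A \<rho> E) = n"
proof
  show mero: "meromorphic_end (model_end A \<rho> E)"
    using model_end_forms(1,2) unfolding meromorphic_end_def by blast
  have "reduced_form_with (model_end A \<rho> E) n"
    using assms reduced_form_with_iff[OF model_end_forms] by blast
  then show "end_type (model_end A \<rho> E) = n"
    unfolding end_type_def using affinely_equivalent_refl
    by (intro the1_equality[OF ex1_end_type[OF mero]]) blast
qed

text \<open>With these rules minimality of the models is a computation: a smaller triple would make
  so many entries of \<open>M\<close> vanish that its determinant is 0.\<close>

lemmas order_simps = principal_orders_def transform_nth complex_eq_iff
  invertible_det_nz det_3

text \<open>In terms of \<open>\<zeta> = 1 / z\<close> the end is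
  \<open>(- ln (norm \<zeta>), - Re \<zeta>, Im \<zeta>)\<close>, a logarithmic graph over the
  exterior of a disc.\<close>

lemma end_type_model_1_2_2:
  "meromorphic_end (model_end (vector [0, 1, \<i>]) (vector [1, 0, 0]) 0) \<and>
   end_type (model_end (vector [0, 1, \<i>]) (vector [1, 0, 0]) 0) = (1, 2, 2)"
  by (rule end_type_model_end) (auto simp: order_simps)

lemma end_type_model_0_2_2:
  "meromorphic_end (model_end (vector [0, 1, \<i>]) 0 0) \<and>
   end_type (model_end (vector [0, 1, \<i>]) 0 0) = (0, 2, 2)"
  by (rule end_type_model_end) (auto simp: order_simps)

lemma end_type_model_0_1_2:
  "meromorphic_end (model_end (vector [0, 0, - 1]) (vector [0, 1, 0]) (vector [- \<i>, 0, 0])) \<and>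
   end_type (model_end (vector [0, 0, - 1]) (vector [0, 1, 0]) (vector [- \<i>, 0, 0])) = (0, 1, 2)"
  by (rule end_type_model_end) (auto simp: order_simps)

lemma end_type_model_0_0_2:
  "meromorphic_end (model_end (vector [0, 0, 1]) 0 0) \<and>
   end_type (model_end (vector [0, 0, 1]) 0 0) = (0, 0, 2)"
  by (rule end_type_model_end) (auto simp: order_simps)

text \<open>This end is \<open>z \<mapsto> (Im z, ln|z|, Re(1/z))\<close>.\<close>

lemma properly_embedded_model_0_1_2:
  "properly_embedded_end (model_end (vector [0, 0, - 1]) (vector [0, 1, 0]) (vector [- \<i>, 0, 0]))"
    (is "properly_embedded_end ?f")
proof -
  have f: "?f z $ 1 = Im z" "?f z $ 2 = ln (norm z)" "?f z $ 3 = Re (1 / z)" for z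
    by (simp_all add: model_end_def)
  have "inj_on ?f punctured_disk"
  proof (rule inj_onI)
    fix z w assume zw: "z \<in> punctured_disk" "w \<in> punctured_disk" "?f z = ?f w"
    have nz: "norm z > 0" "norm w > 0"
      using zw by (auto simp: punctured_disk_def)
    have eqs: "Im z = Im w" "ln (norm z) = ln (norm w)" "Re (1 / z) = Re (1 / w)"
      using zw(3) f by metis+
    \<comment> \<open>The logarithm fixes the modulus, after which the third coordinate fixes the
      real part.\<close>
    have "norm z = norm w"
      using eqs(2) nz by simp
    moreover have "Re (1 / x) = Re x / (norm x)\<^sup>2" for x
      by (simp add: Re_divide cmod_power2)
    ultimately have "Re z / (norm w)\<^sup>2 = Re w / (norm w)\<^sup>2"
      using eqs(3) by metis
    then have "Re z = Re w"
      using nz by simp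
    then show "z = w"
      using eqs(1) by (simp add: complex_eq_iff)
  qed
  moreover have "immersion_on ?f punctured_disk"
    unfolding immersion_on_def
  proof
    fix z assume z: "z \<in> punctured_disk"
    let ?\<omega> = "model_forms (vector [0, 0, - 1]) (vector [0, 1, 0]) (vector [- \<i>, 0, 0]) z"
    let ?D = "\<lambda>h. (\<chi> k. Re (?\<omega> $ k * h)) :: real ^ 3"
    have D: "(?f has_derivative ?D) (at z)"
      by (rule has_derivative_vec_of_Re_integral[OF model_end_forms(1,2) z])
    have z0: "z \<noteq> 0"
      using z by (auto simp: punctured_disk_def)
    have "h = 0" if h: "?D h = 0" for h
    proof -
      have "Re (?\<omega> $ k * h) = 0" for k
        using h by (simp add: vec_eq_iff)
      from this[of 1] this[of 2] this[of 3]
      have *: "Im h = 0" "Re (h / z) = 0" "Re (h / z\<^sup>2) = 0"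
        by (simp_all add: model_forms_def)
      have h: "h = of_real (Re h)"
        using *(1) by (simp add: complex_eq_iff)
      show "h = 0"
      proof (rule ccontr)
        assume "h \<noteq> 0"
        then have "Re h \<noteq> 0" using h by auto
        \<comment> \<open>A nonzero real kernel vector makes \<open>z\<close> purely imaginary; its
          square is then a negative real, so the third condition fails.\<close>
        have "Re h * Re z = 0"
          using *(1,2) z0 by (auto simp: Re_divide sum_power2_eq_zero_iff complex_eq_iff)
        then have "Re z = 0" using \<open>Re h \<noteq> 0\<close> by simp
        then have "z\<^sup>2 = of_real (- (Im z)\<^sup>2)"
          by (simp add: complex_eq_iff power2_eq_square)
        then have "Re (h / z\<^sup>2) = Re h / (- (Im z)\<^sup>2)"
          by (simp only: Re_divide_of_real)
        then show False
          using *(3) \<open>Re h \<noteq> 0\<close> \<open>Re z = 0\<close> z0 by (simp add: complex_eq_iff)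
      qed
    qed
    then have "inj ?D"
      using linear_injective_0[OF has_derivative_linear[OF D]] by blast
    then show "\<exists>D. (?f has_derivative D) (at z) \<and> inj D"
      using D by blast
  qed
  moreover have "proper_end ?f"
  proof -
    have "filterlim (\<lambda>z::complex. norm z) (at_right 0) (at 0)"
      by (auto simp: filterlim_at eventually_at_filter intro!: tendsto_eq_intros)
    then have "filterlim (\<lambda>z::complex. ln (norm z)) at_bot (at 0)"
      by (rule filterlim_compose[OF ln_at_0])
    then have "filterlim (\<lambda>z::complex. - ln (norm z)) at_top (at 0)"
      by (simp add: filterlim_uminus_at_top)
    \<comment> \<open>The logarithmic coordinate alone already forces properness.\<close>
    moreover have "- ln (norm z) \<le> norm (?f z)" for z
      using component_le_norm_cart[of "?f z" 2] f(2)[of z] by linarith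
    then have "eventually (\<lambda>z. - ln (norm z) \<le> norm (?f z)) (at 0)"
      by simp
    ultimately show ?thesis
      unfolding proper_end_def by (rule filterlim_at_top_mono)
  qed
  ultimately show ?thesis
    unfolding properly_embedded_end_def punctured_disk_eq by (intro conjI exI[of _ 1]) auto
qed

theorem theorem2p5:
  shows "end_type ` {f. meromorphic_end f \<and> end_order f = 2} =
           {(1, 2, 2), (0, 2, 2), (0, 1, 2), (0, 0, 2)}
    \<and> (\<forall>f. meromorphic_end f \<and> end_type f = (1, 2, 2) \<longrightarrow> properly_embedded_end f)
    \<and> (\<forall>f. meromorphic_end f \<and> end_type f = (0, 2, 2) \<longrightarrow> properly_embedded_end f)
    \<and> (\<exists>f. meromorphic_end f \<and> end_type f = (0, 1, 2) \<and> properly_embedded_end f)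
    \<and> (\<forall>f. meromorphic_end f \<and> end_type f = (0, 0, 2) \<longrightarrow> \<not> proper_end f)"
proof -
  have "n \<in> end_type ` {f. meromorphic_end f \<and> end_order f = 2}"
    if "meromorphic_end f \<and> end_type f = n" "snd (snd n) = 2" for f n
    using that by (auto simp: end_order_def)
  from this[OF end_type_model_1_2_2] this[OF end_type_model_0_2_2]
    this[OF end_type_model_0_1_2] this[OF end_type_model_0_0_2]
  have "end_type ` {f. meromorphic_end f \<and> end_order f = 2} =
      {(1, 2, 2), (0, 2, 2), (0, 1, 2), (0, 0, 2)}"
    using end_type_of_order_2 by (intro subset_antisym image_subsetI) auto
  then show ?thesis
    using properly_embedded_end_type_n_2_2 not_proper_end_type_0_0_2
      end_type_model_0_1_2 properly_embedded_model_0_1_2 by blast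
qed

end
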